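(* Let $P$ be a regular convex $n$-gon with vertices $A_0,\dots,A_{n-1}$ (indices mod $n$), let $l$ be the line perpendicular to the plane of $P$ through its center, and let $O_0\ne O_1$ be points of $l$ not lying in the plane of $P$. Let $\mathcal D$ be the dipyramid with vertices $O_0,O_1$, and let $f\colon\mathcal D\to\mathbb{R}$ be convex on every simplex $O_0O_1A_kA_{k+1}$, $k=0,\dots,n-1$. For $i=0,1$ let $\eta_i$ be the angle between $l$ and the plane of a side $\operatorname{conv}\{O_i,A_k,A_{k+1}\}$ of $\mathcal U_{O_i}$. For $0<s<1$ let $O_s=(1-s)O_0+sO_1$, and let $\mathcal D_s^0$ and $\mathcal D_s^1$ be the dipyramids with vertices $O_0,O_s$ and $O_1,O_s$ respectively. Then for all $0<s<1$: $$\operatorname{Avg}(f,\mathcal D)\le\tfrac14f(O_s)+\tfrac34\left(s\operatorname{Avg}(f,\mathcal U_{O_0})+(1-s)\operatorname{Avg}(f,\mathcal U_{O_1})\right),$$ $$s\operatorname{Avg}(f,h_{O_s}^{3/4}(\mathcal U_{O_0}))+(1-s)\operatorname{Avg}(f,h_{O_s}^{3/4}(\mathcal U_{O_1}))\le\operatorname{Avg}(f,\mathcal D),$$ $$\operatorname{Avg}(f,\partial h_{O_s}^{3/4}(\mathcal D))\le\frac{\sin\eta_1}{\sin\eta_0+\sin\eta_1}\operatorname{Avg}(f,\mathcal D_s^0)+\frac{\sin\eta_0}{\sin\eta_0+\sin\eta_1}\operatorname{Avg}(f,\mathcal D_s^1).$$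
   Context: For a point $X\in l$, the Chinese umbrella with vertex $X$ is $\mathcal U_X=\bigcup_{k=0}^{n-1}\operatorname{conv}\{X,A_k,A_{k+1}\}$. The dipyramid with vertices $X,Y\in l$ is the body bounded by $\mathcal U_X$ and $\mathcal U_Y$, i.e. $\bigcup_{k=0}^{n-1}\operatorname{conv}\{X,Y,A_k,A_{k+1}\}$ (it need not be convex). Averages over dipyramids are with respect to volume, and averages over umbrellas and boundary surfaces are with respect to surface area. $h_{\mathbf a}^\lambda(\mathbf x)=\mathbf a+\lambda(\mathbf x-\mathbf a)$. *)

theory Defs
  imports "HOL-Analysis.Analysis"
begin

type_synonym tri = "(real^3) \<times> (real^3) \<times> (real^3)"

definition homothety :: "real^3 \<Rightarrow> real \<Rightarrow> real^3 \<Rightarrow> real^3" where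
  "homothety a lam x = a + lam *\<^sub>R (x - a)"

(* Dipyramid with vertices X, Y over the polygon A 0, ..., A (n-1)
   (indices mod n are realised by an n-periodic vertex function A). *)
definition dipyramid :: "real^3 \<Rightarrow> real^3 \<Rightarrow> (nat \<Rightarrow> real^3) \<Rightarrow> nat \<Rightarrow> (real^3) set" where
  "dipyramid X Y A n = (\<Union>k<n. convex hull {X, Y, A k, A (Suc k)})"

definition vol_avg :: "(real^3 \<Rightarrow> real) \<Rightarrow> (real^3) set \<Rightarrow> real" where
  "vol_avg f S = integral S f / measure lebesgue S"

(* A triangular (polyhedral) surface is given by a list of triangles conv{X,A,B}.
   Surface integrals are computed through the affine parametrisation of each triangle
   over the standard simplex, with area element |(A-X) x (B-X)|. *)
definition std_tri :: "(real^2) set" where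
  "std_tri = {p. 0 \<le> p$1 \<and> 0 \<le> p$2 \<and> p$1 + p$2 \<le> 1}"

definition tri_integral :: "(real^3 \<Rightarrow> real) \<Rightarrow> tri \<Rightarrow> real" where
  "tri_integral f T = (case T of (X, A, B) \<Rightarrow>
     integral std_tri (\<lambda>p. f (X + (p$1) *\<^sub>R (A - X) + (p$2) *\<^sub>R (B - X)))
       * norm (cross3 (A - X) (B - X)))"

definition tri_area :: "tri \<Rightarrow> real" where
  "tri_area T = (case T of (X, A, B) \<Rightarrow> norm (cross3 (A - X) (B - X)) / 2)"

definition surf_avg :: "(real^3 \<Rightarrow> real) \<Rightarrow> (tri) list \<Rightarrow> real" where
  "surf_avg f ts = (\<Sum>T\<leftarrow>ts. tri_integral f T) / (\<Sum>T\<leftarrow>ts. tri_area T)"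

definition umbrella :: "real^3 \<Rightarrow> (nat \<Rightarrow> real^3) \<Rightarrow> nat \<Rightarrow> (tri) list" where
  "umbrella X A n = map (\<lambda>k. (X, A k, A (Suc k))) [0..<n]"

(* Image of a triangulated surface under a map (used for homotheties, which are affine,
   so the image of conv{X,A,B} is conv{h X, h A, h B}). *)
definition map_surf :: "(real^3 \<Rightarrow> real^3) \<Rightarrow> (tri) list \<Rightarrow> (tri) list" where
  "map_surf h ts = map (\<lambda>(X, A, B). (h X, h A, h B)) ts"

definition dipyramid_boundary :: "real^3 \<Rightarrow> real^3 \<Rightarrow> (nat \<Rightarrow> real^3) \<Rightarrow> nat \<Rightarrow> (tri) list" where
  "dipyramid_boundary X Y A n = umbrella X A n @ umbrella Y A n"

definition angle_line_plane :: "real^3 \<Rightarrow> real^3 \<Rightarrow> real^3 \<Rightarrow> real^3 \<Rightarrow> real" where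
  "angle_line_plane d X A B =
     (let N = cross3 (A - X) (B - X) in arcsin (\<bar>d \<bullet> N\<bar> / (norm d * norm N)))"

end

theory Submission
  imports Defs
begin

text \<open>
  Slice a tetrahedron with apex \<open>P\<close> and base \<open>XAB\<close> by the homothetic images of its base with centre
  \<open>P\<close> and ratio \<open>\<tau>\<close>. If \<open>\<Psi> \<tau>\<close> is the mean of the convex function \<open>f\<close> over the slice, then \<open>\<Psi>\<close> is
  convex on \<open>[0,1]\<close>, \<open>\<Psi> 0 = f P\<close>, \<open>\<Psi> 1\<close> is the mean over the base, and the mean over the tetrahedron is
  the integral of \<open>3\<tau>\<^sup>2 \<Psi> \<tau>\<close>. The chord of \<open>\<Psi>\<close> gives the upper bound \<open>1/4 f P + 3/4 \<Psi> 1\<close>, and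
  Jensen's inequality the lower bound \<open>\<Psi> (3/4)\<close>.

  The point \<open>O\<^sub>s\<close> cuts each tetrahedron \<open>O\<^sub>0 O\<^sub>1 A\<^sub>k A\<^sub>k\<^sub>+\<^sub>1\<close> into two tetrahedra with apex \<open>O\<^sub>s\<close> whose bases
  are faces of the umbrellas and whose volumes are in the ratio \<open>s : 1 - s\<close>. By symmetry all volumes and
  face areas are independent of \<open>k\<close>, so summing over \<open>k\<close> gives the first two inequalities. For the third,
  all faces project onto triangles of equal area in the plane of the polygon, so the area of a face of
  the umbrella over \<open>O\<^sub>i\<close> is inversely proportional to \<open>sin \<eta>\<^sub>i\<close>.
\<close>

section \<open>Convex functions on polytopes\<close>

text \<open>The maximum over the vertices bounds \<open>f\<close> from above. For the lower bound,
  every \<open>x\<close> has a partner \<open>z\<close> in the polytope such that the centroid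
  \<open>c\<close> of the vertices lies on the segment from \<open>x\<close> to \<open>z\<close>
  with the fixed weight \<open>1/m\<close> at \<open>x\<close>. Convexity at \<open>c\<close> then
  bounds \<open>f x\<close> from below by \<open>f c\<close> and the upper bound at
  \<open>z\<close>.\<close>

lemma convex_on_polytope_bounded:
  fixes f :: "'a::euclidean_space \<Rightarrow> real"
  assumes fin: "finite V" and conv: "convex_on (convex hull V) f"
  obtains B where "\<And>x. x \<in> convex hull V \<Longrightarrow> \<bar>f x\<bar> \<le> B"
proof (cases "V = {}")
  case True
  then show ?thesis using that by auto
next
  case False
  define M where "M = Max (f ` V)"
  have M: "f x \<le> M" if "x \<in> convex hull V" for x
    using convex_on_convex_hull_bound[OF conv, of M] fin that by (auto simp: M_def)
  define m where "m = real (card V)"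
  have m: "m \<ge> 1"
    using False fin by (simp add: m_def Suc_leI card_gt_0_iff)
  define c where "c = (\<Sum>x\<in>V. (1/m) *\<^sub>R x)"
  \<comment> \<open>Obtained by solving \<open>f c <= 1/m * f x + (1 - 1/m) * M\<close> for
    \<open>f x\<close>.\<close>
  define L where "L = m * f c - (m - 1) * M"
  have lower: "L \<le> f x" if x: "x \<in> convex hull V" for x
  proof -
    from x obtain w where w: "\<And>y. y \<in> V \<Longrightarrow> 0 \<le> w y" "sum w V = 1" "(\<Sum>y\<in>V. w y *\<^sub>R y) = x"
      by (auto simp: convex_hull_finite[OF fin])
    show ?thesis
    proof (cases "m = 1")
      case True
      then have "card V = 1" by (simp add: m_def)
      then obtain a where "V = {a}" by (auto simp: card_1_singleton_iff)
      then show ?thesis using x True by (simp add: L_def c_def)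
    next
      case False
      with m have m1: "m > 1" by simp
      have w1: "w y \<le> 1" if "y \<in> V" for y
        using member_le_sum[OF that, of w] w fin by auto
      \<comment> \<open>The complementary weights \<open>1 - w y\<close> add up to
        \<open>m - 1\<close>; this is why \<open>m = 1\<close> is treated apart.\<close>
      define z where "z = (\<Sum>y\<in>V. ((1 - w y) / (m - 1)) *\<^sub>R y)"
      have sz: "(\<Sum>y\<in>V. (1 - w y) / (m - 1)) = 1"
        using m1 w(2) fin by (simp add: sum_divide_distrib[symmetric] sum_subtractf m_def)
      have z: "z \<in> convex hull V"
        unfolding z_def
        by (rule convex_sum[OF fin convex_convex_hull sz]) (use w1 m1 in \<open>auto simp: hull_inc\<close>)
      have "c = (1/m) *\<^sub>R x + (1 - 1/m) *\<^sub>R z"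
        unfolding c_def z_def w(3)[symmetric] scaleR_sum_right sum.distrib[symmetric]
      proof (rule sum.cong[OF refl])
        fix y
        have "1/m = 1/m * w y + (1 - 1/m) * ((1 - w y) / (m - 1))"
          using m1 by (simp add: field_simps)
        then show "(1/m) *\<^sub>R y = (1/m) *\<^sub>R (w y *\<^sub>R y) + (1 - 1/m) *\<^sub>R (((1 - w y) / (m - 1)) *\<^sub>R y)"
          by (metis scaleR_left_distrib scaleR_scaleR)
      qed
      then have "f c \<le> 1/m * f x + (1 - 1/m) * f z"
        using convex_onD[OF conv, of "1 - 1/m" x z] x z m1 by simp
      also have "\<dots> \<le> 1/m * f x + (1 - 1/m) * M"
        using M[OF z] m1 by (intro add_left_mono mult_left_mono) auto
      finally have "m * f c \<le> m * (1/m * f x + (1 - 1/m) * M)"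
        using m1 by (intro mult_left_mono) auto
      then show ?thesis
        using m1 by (simp add: L_def algebra_simps)
    qed
  qed
  show ?thesis
    by (rule that[of "max \<bar>M\<bar> \<bar>L\<bar>"]) (use M lower in \<open>force\<close>)
qed

text \<open>Convexity gives continuity only on open sets; on the boundary of the hull
  \<open>f\<close> may jump. Restricting to an open \<open>U\<close> yields Borel measurability,
  which Fubini's theorem for \<open>lborel\<close> uses below.\<close>

lemma convex_on_integrable_lborel_indicator:
  fixes f :: "'a::euclidean_space \<Rightarrow> real"
  assumes fin: "finite V" and conv: "convex_on (convex hull V) f"
    and U: "open U" "U \<subseteq> convex hull V" "convex U"
  shows "integrable lborel (\<lambda>x. indicator U x *\<^sub>R f x)"
proof -
  obtain B where B: "\<And>x. x \<in> convex hull V \<Longrightarrow> \<bar>f x\<bar> \<le> B"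
    using convex_on_polytope_bounded[OF fin conv] by blast
  have "continuous_on U f"
    using convex_on_continuous[OF U(1)] convex_on_subset[OF conv U(2,3)] by blast
  then have meas: "(\<lambda>x. indicator U x *\<^sub>R f x) \<in> borel_measurable borel"
    using U by (intro borel_measurable_continuous_on_indicator) auto
  have "bounded U"
    using bounded_subset[OF _ U(2)] fin by (simp add: bounded_convex_hull finite_imp_bounded)
  then have "emeasure lborel U < \<infinity>"
    by (rule emeasure_bounded_finite)
  \<comment> \<open>The inner indicator makes the integrand globally measurable; the two indicators
    then merge into one.\<close>
  then have "integrable lborel (\<lambda>x. indicator U x *\<^sub>R (indicator U x *\<^sub>R f x))"
    using U(1,2) B meas
    by (intro integrableI_bounded_set_indicator[where B=B]) (auto simp: indicator_def)
  then show ?thesis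
    by (simp add: mult.assoc[symmetric] indicator_inter_arith[symmetric])
qed

text \<open>The frontier of a convex set is null, so the behaviour of \<open>f\<close> in the
  interior decides. A flat polytope is covered too, with empty interior.\<close>

lemma convex_on_polytope_absolutely_integrable:
  fixes f :: "'a::euclidean_space \<Rightarrow> real"
  assumes fin: "finite V" and conv: "convex_on (convex hull V) f"
  shows "f absolutely_integrable_on (convex hull V)"
proof -
  let ?S = "convex hull V"
  have "integrable lborel (\<lambda>x. indicator (interior ?S) x *\<^sub>R f x)"
    by (rule convex_on_integrable_lborel_indicator[OF fin conv])
       (auto simp: interior_subset convex_interior)
  then have "f absolutely_integrable_on (interior ?S)"
    unfolding set_integrable_def
    by (subst integrable_completion) (auto dest: borel_measurable_integrable)
  moreover have "negligible (?S - interior ?S)"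
    using negligible_convex_frontier[OF convex_convex_hull]
    by (rule negligible_subset) (auto simp: frontier_def intro: closure_subset[THEN subsetD])
  ultimately show ?thesis
    by (subst absolutely_integrable_spike_set_eq[where T = "interior ?S"])
       (auto intro: negligible_subset interior_subset[THEN subsetD])
qed

section \<open>Slicing a tetrahedron\<close>

text \<open>The unit cone over \<open>std_tri\<close> with apex \<open>0\<close>: the first coordinate is the height above the apex,
  the slice at height \<open>\<tau>\<close> is \<open>\<tau> *\<^sub>R std_tri\<close>.\<close>

definition slant_tet :: "(real^3) set" where
  "slant_tet = {q. q$1 \<le> 1 \<and> 0 \<le> q$2 \<and> 0 \<le> q$3 \<and> q$2 + q$3 \<le> q$1}"

lemma vector3_eq: "(vector [a,b,c] :: real^3) = a *\<^sub>R axis 1 1 + b *\<^sub>R axis 2 1 + c *\<^sub>R axis 3 1"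
  by (simp add: vec_eq_iff forall_3 axis_def)

lemma prod_inner_Basis_cart: "(\<Prod>b\<in>Basis. x \<bullet> b) = (\<Prod>i\<in>UNIV. x $ i)" for x :: "real^'n"
proof -
  have inj: "inj (\<lambda>i. axis i 1 :: real^'n)"
    by (simp add: inj_on_def axis_eq_axis)
  have Basis: "(Basis :: (real^'n) set) = range (\<lambda>i. axis i 1)"
    by (auto simp: Basis_vec_def)
  show ?thesis
    unfolding Basis prod.reindex[OF inj] comp_def by (simp add: inner_axis)
qed

text \<open>Lets Fubini's theorem separate the height coordinate from the two slice coordinates.
  Lebesgue measure is determined by its values on boxes, and the preimage of a box is a product of
  boxes.\<close>

lemma lborel_vec3_pair:
  "lborel = distr (lborel :: (real \<times> (real^2)) measure) borel (\<lambda>(t, p). vector [t, p$1, p$2] :: real^3)"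
proof (rule lborel_eqI)
  let ?g = "\<lambda>(t, p :: real^2). vector [t, p$1, p$2] :: real^3"
  have cont: "continuous_on UNIV ?g"
    unfolding case_prod_unfold vector3_eq by (intro continuous_intros)
  then have [measurable]: "?g \<in> borel_measurable borel"
    by (rule borel_measurable_continuous_onI)
  fix l u :: "real^3"
  assume lu: "\<And>b. b \<in> Basis \<Longrightarrow> l \<bullet> b \<le> u \<bullet> b"
  have lu': "l $ i \<le> u $ i" for i
    using lu[of "axis i 1"] by (simp add: inner_axis axis_in_Basis_iff)
  have B3: "(\<Prod>b\<in>Basis. (u - l) \<bullet> b) = (u$1-l$1)*(u$2-l$2)*(u$3-l$3)"
    unfolding prod_inner_Basis_cart UNIV_3 by simp
  have "?g -` box l u = box (l$1) (u$1) \<times> box (vector [l$2,l$3]) (vector [u$2,u$3])"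
    by (auto simp: mem_box_cart forall_3 forall_2)
  then have "emeasure (distr lborel borel ?g) (box l u) =
      emeasure (lborel \<Otimes>\<^sub>M lborel) (box (l$1) (u$1) \<times> box (vector [l$2,l$3] :: real^2) (vector [u$2,u$3]))"
    by (simp add: emeasure_distr lborel_prod)
  also have "\<dots> = emeasure lborel (box (l$1) (u$1)) * emeasure lborel (box (vector [l$2,l$3] :: real^2) (vector [u$2,u$3]))"
    by (rule lborel.emeasure_pair_measure_Times) auto
  also have "emeasure lborel (box (vector [l$2,l$3] :: real^2) (vector [u$2,u$3])) = (u$2-l$2)*(u$3-l$3)"
  proof -
    have "\<forall>i. (vector [l$2,l$3] :: real^2) $ i \<le> (vector [u$2,u$3] :: real^2) $ i"
      unfolding forall_2 using lu' by simp
    then have le2: "(vector [l$2,l$3] :: real^2) $ i \<le> (vector [u$2,u$3] :: real^2) $ i" for i ..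
    have "emeasure lborel (box (vector [l$2,l$3] :: real^2) (vector [u$2,u$3])) =
        (\<Prod>b\<in>Basis. (vector [u$2,u$3] - vector [l$2,l$3] :: real^2) \<bullet> b)"
      by (rule emeasure_lborel_box)
         (use le2 in \<open>auto simp: Basis_vec_def inner_axis\<close>)
    then show ?thesis
      unfolding prod_inner_Basis_cart UNIV_2 by simp
  qed
  also have "emeasure lborel (box (l$1) (u$1)) = u$1-l$1"
    using lu' by (subst emeasure_lborel_box) auto
  finally show "emeasure (distr lborel borel ?g) (box l u) = (\<Prod>b\<in>Basis. (u - l) \<bullet> b)"
    using lu' unfolding B3 by (simp add: ennreal_mult'[symmetric] mult.assoc)
qed simp

lemma mem_convex_hull_4:
  assumes "0 \<le> a" "0 \<le> b" "0 \<le> c" "0 \<le> d" "a + b + c + d = 1"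
  shows "a *\<^sub>R P + b *\<^sub>R X + c *\<^sub>R A + d *\<^sub>R B \<in> convex hull {P, X, A, B}"
proof -
  let ?w = "\<lambda>i::nat. [a,b,c,d] ! i" and ?y = "\<lambda>i. [P,X,A,B] ! i"
  have "(\<Sum>i<4. ?w i *\<^sub>R ?y i) \<in> convex hull {P, X, A, B}"
    using assms by (intro convex_sum)
      (auto simp: eval_nat_numeral lessThan_Suc less_Suc_eq hull_inc add.assoc)
  then show ?thesis
    by (simp add: eval_nat_numeral add.assoc)
qed

text \<open>In barycentric terms \<open>q$1\<close> is one minus the weight of \<open>P\<close>,
  while \<open>q$2\<close> and \<open>q$3\<close> are the weights of \<open>A\<close> and
  \<open>B\<close>. The slice at height \<open>q$1\<close> goes to the image of the base
  \<open>XAB\<close> under the homothety with centre \<open>P\<close> and ratio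
  \<open>q$1\<close>.\<close>

lemma convex_hull_4_cone:
  "convex hull {P, X, A, B :: real^3} =
     (\<lambda>q. P + q$1 *\<^sub>R (X - P) + q$2 *\<^sub>R (A - X) + q$3 *\<^sub>R (B - X)) ` slant_tet"
  (is "_ = ?m ` _")
proof
  show "convex hull {P, X, A, B} \<subseteq> ?m ` slant_tet"
  proof
    fix y assume "y \<in> convex hull {P, X, A, B}"
    then obtain t a b where t: "0 \<le> t" "t \<le> 1" and ab: "0 \<le> a" "0 \<le> b" "a + b \<le> 1"
      and y: "y = (1 - t) *\<^sub>R P + t *\<^sub>R (X + a *\<^sub>R (A - X) + b *\<^sub>R (B - X))"
      by (auto simp: convex_hull_insert_alt[of P] convex_hull_3_alt)
    have "y = ?m (vector [t, t * a, t * b])"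
      by (simp add: y algebra_simps)
    moreover have "vector [t, t * a, t * b] \<in> slant_tet"
      using t ab mult_left_mono[OF ab(3) t(1)] by (simp add: slant_tet_def algebra_simps)
    ultimately show "y \<in> ?m ` slant_tet" by blast
  qed
  show "?m ` slant_tet \<subseteq> convex hull {P, X, A, B}"
  proof
    fix y assume "y \<in> ?m ` slant_tet"
    then obtain q where q: "q$1 \<le> 1" "0 \<le> q$2" "0 \<le> q$3" "q$2 + q$3 \<le> q$1" and y: "y = ?m q"
      by (auto simp: slant_tet_def)
    have "y = (1 - q$1) *\<^sub>R P + (q$1 - q$2 - q$3) *\<^sub>R X + q$2 *\<^sub>R A + q$3 *\<^sub>R B"
      by (simp add: y algebra_simps)
    also have "\<dots> \<in> convex hull {P, X, A, B}"
      using q by (intro mem_convex_hull_4) auto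
    finally show "y \<in> convex hull {P, X, A, B}" .
  qed
qed

text \<open>For these four vertices the cone map of \<open>convex_hull_4_cone\<close> is the
  identity. The hull form supplies convexity and compactness.\<close>

lemma slant_tet_hull:
  "slant_tet = convex hull {0, axis 1 1, axis 1 1 + axis 2 1, axis 1 1 + axis 3 1}"
proof -
  have "(0::real^3) + q$1 *\<^sub>R (axis 1 1 - 0) + q$2 *\<^sub>R (axis 1 1 + axis 2 1 - axis 1 1)
      + q$3 *\<^sub>R (axis 1 1 + axis 3 1 - axis 1 1) = q" for q :: "real^3"
    by (simp add: vec_eq_iff forall_3 axis_def)
  then show ?thesis
    unfolding convex_hull_4_cone by simp
qed

lemma std_tri_hull: "std_tri = convex hull {0, axis 1 1, axis 2 1}"
proof -
  have "p \<in> std_tri \<longleftrightarrow> (\<exists>a b. p = a *\<^sub>R axis 1 1 + b *\<^sub>R axis 2 1 \<and> 0 \<le> a \<and> 0 \<le> b \<and> a + b \<le> 1)"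
    for p :: "real^2"
    by (auto simp: std_tri_def vec_eq_iff forall_2 axis_def)
  then show ?thesis
    by (auto simp: convex_hull_3_alt)
qed

lemma lborel_integral_affine:
  fixes f :: "'a::euclidean_space \<Rightarrow> real"
  assumes c: "c > 0" and [measurable]: "f \<in> borel_measurable borel"
  shows "(\<integral>x. f x \<partial>lborel) = c ^ DIM('a) * (\<integral>x. f (c *\<^sub>R x) \<partial>lborel)"
  by (subst lborel_affine[of c 0])
     (use c in \<open>simp_all add: integral_density integral_distr\<close>)

lemma convex_on_affine_comp:
  fixes m :: "'a::real_vector \<Rightarrow> 'b::real_vector"
  assumes f: "convex_on T f" and S: "convex S" and m: "m ` S \<subseteq> T"
    and aff: "\<And>x y t. m ((1 - t) *\<^sub>R x + t *\<^sub>R y) = (1 - t) *\<^sub>R m x + t *\<^sub>R m y"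
  shows "convex_on S (\<lambda>x. f (m x))"
proof (rule convex_onI[OF _ S])
  fix t x y assume "0 < t" "t < (1::real)" and xy: "x \<in> S" "y \<in> S"
  then show "f (m ((1 - t) *\<^sub>R x + t *\<^sub>R y)) \<le> (1 - t) * f (m x) + t * f (m y)"
    unfolding aff using m by (intro convex_onD[OF f]) auto
qed

text \<open>Fubini in the first coordinate, followed by rescaling each planar slice to
  \<open>std_tri\<close>, which produces the factor \<open>\<tau>\<^sup>2\<close>. The open sets
  \<open>S\<close> and \<open>Q\<close> replace the closed bodies up to null sets, so that the
  integrands are Borel measurable.\<close>

lemma integral_slant_tet_slices:
  fixes g :: "real^3 \<Rightarrow> real"
  assumes g: "convex_on slant_tet g"
  shows "((\<lambda>\<tau>. \<tau>\<^sup>2 * integral std_tri (\<lambda>p. g (vector [\<tau>, \<tau> * p$1, \<tau> * p$2])))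
           has_integral integral slant_tet g) {0..1}"
proof -
  define S where "S = {q :: real^3. q$1 < 1 \<and> 0 < q$2 \<and> 0 < q$3 \<and> q$2 + q$3 < q$1}"
  define Q where "Q = {p :: real^2. 0 < p$1 \<and> 0 < p$2 \<and> p$1 + p$2 < 1}"
  let ?v = "\<lambda>(\<tau>, p :: real^2). vector [\<tau>, p$1, p$2] :: real^3"
  have S_eq: "S = {q. (axis 1 1) \<bullet> q < 1} \<inter> {q. axis 2 1 \<bullet> q > 0} \<inter> {q. axis 3 1 \<bullet> q > 0}
      \<inter> {q. (axis 2 1 + axis 3 1 - axis 1 1) \<bullet> q < 0}"
    by (auto simp: S_def inner_axis' inner_diff_left inner_add_left)
  have S: "open S" "convex S" "S \<subseteq> slant_tet"
    unfolding S_eq by (intro open_Int open_halfspace_lt open_halfspace_gt)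
      (intro convex_Int convex_halfspace_lt convex_halfspace_gt,
       auto simp: slant_tet_def inner_axis' inner_diff_left inner_add_left)
  have Q_eq: "Q = {q. axis 1 1 \<bullet> q > 0} \<inter> {q. axis 2 1 \<bullet> q > 0}
      \<inter> {q. (axis 1 1 + axis 2 1) \<bullet> q < 1}"
    by (auto simp: Q_def inner_axis' inner_add_left)
  have Q: "open Q" "convex Q" "Q \<subseteq> std_tri"
    unfolding Q_eq by (intro open_Int open_halfspace_lt open_halfspace_gt)
      (intro convex_Int convex_halfspace_lt convex_halfspace_gt,
       auto simp: std_tri_def inner_axis' inner_add_left)
  have negS: "negligible (slant_tet - S)"
  proof (rule negligible_subset)
    show "negligible ({q. axis 1 1 \<bullet> q = 1} \<union> {q::real^3. axis 2 1 \<bullet> q = 0}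
       \<union> {q. axis 3 1 \<bullet> q = 0} \<union> {q. (axis 2 1 + axis 3 1 - axis 1 1) \<bullet> q = 0})"
      by (intro negligible_Un negligible_hyperplane)
         (auto simp: vec_eq_iff axis_def forall_3)
    show "slant_tet - S \<subseteq> ({q. axis 1 1 \<bullet> q = 1} \<union> {q::real^3. axis 2 1 \<bullet> q = 0}
       \<union> {q. axis 3 1 \<bullet> q = 0} \<union> {q. (axis 2 1 + axis 3 1 - axis 1 1) \<bullet> q = 0})"
      by (auto simp: S_def slant_tet_def inner_axis' inner_add_left inner_diff_left)
  qed
  have negQ: "negligible (std_tri - Q)"
  proof (rule negligible_subset)
    show "negligible ({q::real^2. axis 1 1 \<bullet> q = 0} \<union> {q. axis 2 1 \<bullet> q = 0}
       \<union> {q. (axis 1 1 + axis 2 1) \<bullet> q = 1})"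
      by (intro negligible_Un negligible_hyperplane)
         (auto simp: vec_eq_iff axis_def forall_2)
    show "std_tri - Q \<subseteq> {q::real^2. axis 1 1 \<bullet> q = 0} \<union> {q. axis 2 1 \<bullet> q = 0}
       \<union> {q. (axis 1 1 + axis 2 1) \<bullet> q = 1}"
      by (auto simp: Q_def std_tri_def inner_axis' inner_add_left inner_diff_left)
  qed
  define G where "G = (\<lambda>q. indicator S q *\<^sub>R g q)"
  have G: "integrable lborel G"
    unfolding G_def using g S
    by (intro convex_on_integrable_lborel_indicator[where V = "{0, axis 1 1, axis 1 1 + axis 2 1, axis 1 1 + axis 3 1}"])
       (auto simp: slant_tet_hull)
  then have Gm [measurable]: "G \<in> borel_measurable borel"
    by auto
  have [measurable]: "?v \<in> borel_measurable borel"
    unfolding case_prod_unfold vector3_eq by (intro borel_measurable_continuous_onI continuous_intros)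
  have I: "integral slant_tet g = (\<integral>q. G q \<partial>lborel)"
  proof -
    have "integral slant_tet g = integral S g"
      by (rule integral_spike_set; rule negligible_subset[OF negS]) (use S in auto)
    also have "\<dots> = integral UNIV G"
      unfolding integral_restrict_UNIV[of S g, symmetric]
      by (rule integral_cong) (simp add: G_def)
    finally show ?thesis using integral_lborel[OF G] by simp
  qed
  have Gv: "integrable (lborel \<Otimes>\<^sub>M lborel) (\<lambda>z. G (?v z))"
    using G unfolding lborel_prod by (subst (asm) lborel_vec3_pair) (simp add: integrable_distr_eq)
  have I2: "integral slant_tet g = (\<integral>\<tau>. \<integral>p. G (?v (\<tau>, p)) \<partial>lborel \<partial>lborel)"
    unfolding I lborel_pair.integral_fst'[OF Gv]
    by (subst lborel_vec3_pair) (simp add: integral_distr lborel_prod)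
  let ?\<Phi> = "\<lambda>\<tau>. \<integral>p. G (?v (\<tau>, p)) \<partial>lborel"
  \<comment> \<open>The rescaling is proved only for \<open>0 < \<tau> < 1\<close>; the two
    endpoints are discarded at the end as a finite exceptional set.\<close>
  have \<Phi>_eq: "?\<Phi> \<tau> = \<tau>\<^sup>2 * integral std_tri (\<lambda>p. g (vector [\<tau>, \<tau> * p$1, \<tau> * p$2]))"
    if \<tau>: "0 < \<tau>" "\<tau> < 1" for \<tau>
  proof -
    let ?h = "\<lambda>p :: real^2. g (vector [\<tau>, \<tau> * p$1, \<tau> * p$2])"
    have S_iff: "vector [\<tau>, \<tau> * p$1, \<tau> * p$2] \<in> S \<longleftrightarrow> p \<in> Q" for p :: "real^2"
      using \<tau> by (simp add: S_def Q_def zero_less_mult_iff distrib_left[symmetric])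
    have conv_h: "convex_on std_tri ?h"
    proof (rule convex_on_affine_comp[OF g])
      show "convex std_tri" by (simp add: std_tri_hull)
      show "(\<lambda>p. vector [\<tau>, \<tau> * p$1, \<tau> * p$2]) ` std_tri \<subseteq> slant_tet"
        using \<tau> by (auto simp: std_tri_def slant_tet_def distrib_left[symmetric] mult_le_cancel_left2)
    qed (simp add: vec_eq_iff forall_3 algebra_simps)
    have meas_slice: "(\<lambda>p. G (?v (\<tau>, p))) \<in> borel_measurable borel"
      by (rule measurable_compose[where g = G and N = borel])
         (auto simp: vector3_eq intro!: borel_measurable_continuous_onI continuous_intros)
    have "?\<Phi> \<tau> = \<tau>\<^sup>2 * (\<integral>p. G (?v (\<tau>, \<tau> *\<^sub>R p)) \<partial>lborel)"
      using lborel_integral_affine[OF \<tau>(1), of "\<lambda>p::real^2. G (?v (\<tau>, p))"] meas_slice by simp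
    also have "(\<lambda>p. G (?v (\<tau>, \<tau> *\<^sub>R p))) = (\<lambda>p. indicator Q p *\<^sub>R ?h p)"
      by (auto simp: G_def S_iff indicator_def)
    also have "(\<integral>p. indicator Q p *\<^sub>R ?h p \<partial>lborel) = integral UNIV (\<lambda>p. indicator Q p *\<^sub>R ?h p)"
    proof (rule integral_lborel[symmetric])
      show "integrable lborel (\<lambda>p. indicator Q p *\<^sub>R ?h p)"
        by (rule convex_on_integrable_lborel_indicator[where V = "{0, axis 1 1, axis 2 1}"])
           (use conv_h Q in \<open>simp_all add: std_tri_hull\<close>)
    qed
    also have "\<dots> = integral Q ?h"
      unfolding integral_restrict_UNIV[of Q ?h, symmetric] by (rule integral_cong) simp
    also have "\<dots> = integral std_tri ?h"
      by (rule integral_spike_set; rule negligible_subset[OF negQ]) (auto simp: Q_def std_tri_def)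
    finally show ?thesis .
  qed
  have \<Phi>_0: "?\<Phi> \<tau> = 0" if "\<not> (0 < \<tau> \<and> \<tau> < 1)" for \<tau>
  proof -
    have "(\<lambda>p. G (?v (\<tau>, p))) = (\<lambda>p. 0)"
      using that by (auto simp: G_def S_def indicator_def)
    then show ?thesis by simp
  qed
  have "(?\<Phi> has_integral integral slant_tet g) UNIV"
    using has_integral_integral_lborel[OF lborel_pair.integrable_fst'[OF Gv]] I2 by simp
  then have "((\<lambda>x. if x \<in> {0..1} then ?\<Phi> x else 0) has_integral integral slant_tet g) UNIV"
    by (rule has_integral_eq[rotated]) (use \<Phi>_0 in auto)
  then have "(?\<Phi> has_integral integral slant_tet g) {0..1}"
    by (simp only: has_integral_restrict_UNIV)
  then show ?thesis
    by (rule has_integral_spike_finite[where S = "{0, 1}", rotated 2]) (use \<Phi>_eq in auto)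
qed

section \<open>Transport from the unit cone to an arbitrary tetrahedron\<close>

lemma integral_change_of_variables_real:
  fixes f :: "real^'m::{finite,wellorder} \<Rightarrow> real" and g :: "real^'m::_ \<Rightarrow> real^'m::_"
  assumes S: "S \<in> sets lebesgue"
    and der_g: "\<And>x. x \<in> S \<Longrightarrow> (g has_derivative g' x) (at x within S)"
    and inj: "inj_on g S"
    and f: "f absolutely_integrable_on (g ` S)"
  shows "integral (g ` S) f = integral S (\<lambda>x. \<bar>det (matrix (g' x))\<bar> * f (g x))"
proof -
  let ?f = "\<lambda>x. vec (f x) :: real^1"
  have "?f absolutely_integrable_on (g ` S)"
    using f by (simp add: absolutely_integrable_on_1_iff)
  then have "integral (g ` S) ?f = integral S (\<lambda>x. \<bar>det (matrix (g' x))\<bar> *\<^sub>R ?f (g x))"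
    using integral_change_of_variables[OF S der_g inj, of ?f] by blast
  then show ?thesis
    by (simp add: integral_on_1_eq vec_eq_iff)
qed

text \<open>The scalar triple product, that is, six times the signed volume of the
  tetrahedron.\<close>

definition tet_det :: "real^3 \<Rightarrow> real^3 \<Rightarrow> real^3 \<Rightarrow> real^3 \<Rightarrow> real" where
  "tet_det P X A B = (X - P) \<bullet> cross3 (A - P) (B - P)"

lemma integral_convex_hull_4:
  fixes f :: "real^3 \<Rightarrow> real"
  assumes conv: "convex_on (convex hull {P, X, A, B}) f" and D: "tet_det P X A B \<noteq> 0"
  shows "integral (convex hull {P, X, A, B}) f =
    \<bar>tet_det P X A B\<bar> *
      integral slant_tet (\<lambda>q. f (P + q$1 *\<^sub>R (X - P) + q$2 *\<^sub>R (A - X) + q$3 *\<^sub>R (B - X)))"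
proof -
  define L where "L = (\<lambda>q::real^3. q$1 *\<^sub>R (X - P) + q$2 *\<^sub>R (A - X) + q$3 *\<^sub>R (B - X))"
  have lin: "linear L"
    by (rule linearI) (simp_all add: L_def algebra_simps)
  \<comment> \<open>The columns of \<open>L\<close> are \<open>X - P\<close>, \<open>A - X\<close>,
    \<open>B - X\<close>; adding the first to the other two gives the edge vectors at
    \<open>P\<close>.\<close>
  have det: "det (matrix L) = tet_det P X A B"
    by (simp add: det_3 matrix_def L_def axis_def tet_det_def cross3_def inner_vec_def sum_3 algebra_simps)
  have "inj L"
    using D det det_nz_iff_inj[OF lin] by simp
  have meas: "slant_tet \<in> sets lebesgue"
    unfolding slant_tet_hull
    by (intro lmeasurable_compact[THEN fmeasurableD] compact_convex_hull finite_imp_compact) auto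
  have img: "convex hull {P, X, A, B} = (\<lambda>q. P + L q) ` slant_tet"
    unfolding convex_hull_4_cone by (simp add: L_def add.assoc)
  have "integral ((\<lambda>q. P + L q) ` slant_tet) f =
      integral slant_tet (\<lambda>q. \<bar>det (matrix L)\<bar> * f (P + L q))"
  proof (rule integral_change_of_variables_real[OF meas, where g' = "\<lambda>_. L"])
    show "((\<lambda>q. P + L q) has_derivative L) (at x within slant_tet)" for x
      using has_derivative_add[OF has_derivative_const linear_imp_has_derivative[OF lin]] by simp
    show "inj_on (\<lambda>q. P + L q) slant_tet"
      using \<open>inj L\<close> by (auto simp: inj_on_def)
    show "f absolutely_integrable_on (\<lambda>q. P + L q) ` slant_tet"
      unfolding img[symmetric] by (rule convex_on_polytope_absolutely_integrable) (use conv in auto)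
  qed
  then show ?thesis
    unfolding img det by (simp add: L_def add.assoc)
qed

text \<open>Normalised so that the mean of \<open>f\<close> over the triangle is
  \<open>2 * tri_param_integral f X A B\<close>, whatever its area.\<close>

definition tri_param_integral :: "(real^3 \<Rightarrow> real) \<Rightarrow> real^3 \<Rightarrow> real^3 \<Rightarrow> real^3 \<Rightarrow> real" where
  "tri_param_integral f X A B =
     integral std_tri (\<lambda>p. f (X + p$1 *\<^sub>R (A - X) + p$2 *\<^sub>R (B - X)))"

lemma integral_std_tri_const: "integral std_tri (\<lambda>_. c) = c / (2::real)"
proof -
  \<comment> \<open>With the basis listed explicitly, \<open>std_tri\<close> is recognised as the
    standard simplex spanned by \<open>0\<close> and \<open>Basis\<close>.\<close>
  have B: "(Basis :: (real^2) set) = {axis 1 1, axis 2 1}"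
  proof -
    have "(Basis :: (real^2) set) = range (\<lambda>i. axis i 1)"
      by (auto simp: Basis_vec_def)
    then show ?thesis by (simp only: UNIV_2 image_insert image_empty)
  qed
  have lm: "std_tri \<in> lmeasurable"
    unfolding std_tri_hull by (intro lmeasurable_compact compact_convex_hull finite_imp_compact) auto
  have "measure lborel std_tri = 1 / 2"
    using content_std_simplex[where 'a = "real^2"] unfolding std_tri_hull B[symmetric] by simp
  moreover have "std_tri \<in> sets borel"
    unfolding std_tri_hull by (intro borel_compact compact_convex_hull finite_imp_compact) auto
  ultimately have "measure lebesgue std_tri = 1 / 2"
    by simp
  then have "integral std_tri (\<lambda>_. 1 :: real) = 1 / 2"
    using lmeasure_integral[OF lm] by simp
  then show ?thesis
    using integral_mult_right[of std_tri c "\<lambda>_. 1"] by simp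
qed

lemma homothety_tri_point:
  "homothety P \<tau> X + a *\<^sub>R (homothety P \<tau> A - homothety P \<tau> X) + b *\<^sub>R (homothety P \<tau> B - homothety P \<tau> X)
   = homothety P \<tau> (X + a *\<^sub>R (A - X) + b *\<^sub>R (B - X))"
  by (simp add: homothety_def algebra_simps)

lemma homothety_tri_in_hull:
  assumes "0 \<le> \<tau>" "\<tau> \<le> 1" "p \<in> std_tri"
  shows "homothety P \<tau> (X + p$1 *\<^sub>R (A - X) + p$2 *\<^sub>R (B - X)) \<in> convex hull {P, X, A, B}"
proof -
  have "homothety P \<tau> (X + p$1 *\<^sub>R (A - X) + p$2 *\<^sub>R (B - X)) =
     (1 - \<tau>) *\<^sub>R P + (\<tau> * (1 - p$1 - p$2)) *\<^sub>R X + (\<tau> * p$1) *\<^sub>R A + (\<tau> * p$2) *\<^sub>R B"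
    by (simp add: homothety_def algebra_simps)
  also have "\<dots> \<in> convex hull {P, X, A, B}"
    using assms mult_left_mono[of "p$1 + p$2" 1 \<tau>]
    by (intro mem_convex_hull_4) (auto simp: std_tri_def algebra_simps)
  finally show ?thesis .
qed

lemma homothety_tri_integrable:
  assumes conv: "convex_on (convex hull {P, X, A, B}) f" and \<tau>: "0 \<le> \<tau>" "\<tau> \<le> 1"
  shows "(\<lambda>p. f (homothety P \<tau> (X + p$1 *\<^sub>R (A - X) + p$2 *\<^sub>R (B - X)))) integrable_on std_tri"
proof -
  have "convex_on std_tri (\<lambda>p. f (homothety P \<tau> (X + p$1 *\<^sub>R (A - X) + p$2 *\<^sub>R (B - X))))"
  proof (rule convex_on_affine_comp[OF conv])
    show "convex std_tri" by (simp add: std_tri_hull)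
  qed (use \<tau> homothety_tri_in_hull in \<open>auto simp: homothety_def algebra_simps\<close>)
  then show ?thesis
    using convex_on_polytope_absolutely_integrable[of "{0, axis 1 1, axis 2 1 :: real^2}"]
    unfolding std_tri_hull absolutely_integrable_on_def by simp
qed

text \<open>For fixed \<open>p\<close> the point of the slice moves affinely with
  \<open>\<tau>\<close>, so the integrand is convex in \<open>\<tau>\<close>; integration over
  \<open>p\<close> preserves this.\<close>

lemma convex_on_tri_param_integral_homothety:
  assumes conv: "convex_on (convex hull {P, X, A, B}) f"
  shows "convex_on {0..1} (\<lambda>\<tau>. tri_param_integral f (homothety P \<tau> X) (homothety P \<tau> A) (homothety P \<tau> B))"
    (is "convex_on _ ?\<Psi>")
proof (rule convex_onI)
  fix t \<sigma> \<tau> :: real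
  assume t: "0 < t" "t < 1" and \<sigma>\<tau>: "\<sigma> \<in> {0..1}" "\<tau> \<in> {0..1}"
  let ?x = "\<lambda>\<tau> p. homothety P \<tau> (X + p$1 *\<^sub>R (A - X) + p$2 *\<^sub>R (B - X))"
  have mid: "(1 - t) * \<sigma> + t * \<tau> \<in> {0..1}"
    using convexD_alt[OF convex_real_interval(5)[of 0 1], of \<sigma> \<tau> t] t \<sigma>\<tau> by simp
  have "integral std_tri (\<lambda>p. f (?x ((1 - t) * \<sigma> + t * \<tau>) p))
      \<le> integral std_tri (\<lambda>p. (1 - t) * f (?x \<sigma> p) + t * f (?x \<tau> p))"
  proof (rule integral_le)
    fix p :: "real^2" assume p: "p \<in> std_tri"
    have "?x ((1 - t) * \<sigma> + t * \<tau>) p = (1 - t) *\<^sub>R ?x \<sigma> p + t *\<^sub>R ?x \<tau> p"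
      by (simp add: homothety_def algebra_simps)
    then show "f (?x ((1 - t) * \<sigma> + t * \<tau>) p) \<le> (1 - t) * f (?x \<sigma> p) + t * f (?x \<tau> p)"
      using convex_onD[OF conv] t \<sigma>\<tau> p homothety_tri_in_hull[of _ p] by simp
  qed (use homothety_tri_integrable[OF conv] mid \<sigma>\<tau> in
        \<open>auto intro!: integrable_add integrable_on_mult_right\<close>)
  also have "\<dots> = (1 - t) * integral std_tri (\<lambda>p. f (?x \<sigma> p)) + t * integral std_tri (\<lambda>p. f (?x \<tau> p))"
    using homothety_tri_integrable[OF conv] \<sigma>\<tau>
    by (subst integral_add) (auto intro!: integrable_on_mult_right)
  finally show "?\<Psi> ((1 - t) *\<^sub>R \<sigma> + t *\<^sub>R \<tau>) \<le> (1 - t) * ?\<Psi> \<sigma> + t * ?\<Psi> \<tau>"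
    unfolding tri_param_integral_def homothety_tri_point by simp
qed auto

lemma tetrahedron_integral_slices:
  assumes conv: "convex_on (convex hull {P, X, A, B}) f" and D: "tet_det P X A B \<noteq> 0"
  shows "((\<lambda>\<tau>. \<tau>\<^sup>2 * tri_param_integral f (homothety P \<tau> X) (homothety P \<tau> A) (homothety P \<tau> B))
     has_integral integral (convex hull {P, X, A, B}) f / \<bar>tet_det P X A B\<bar>) {0..1}"
proof -
  let ?m = "\<lambda>q::real^3. P + q$1 *\<^sub>R (X - P) + q$2 *\<^sub>R (A - X) + q$3 *\<^sub>R (B - X)"
  have "convex_on slant_tet (\<lambda>q. f (?m q))"
  proof (rule convex_on_affine_comp[OF conv])
    show "convex slant_tet" by (simp add: slant_tet_hull)
    show "?m ` slant_tet \<subseteq> convex hull {P, X, A, B}"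
      unfolding convex_hull_4_cone by simp
  qed (simp add: algebra_simps)
  from integral_slant_tet_slices[OF this] show ?thesis
    unfolding integral_convex_hull_4[OF conv D] tri_param_integral_def homothety_tri_point
    using D by (simp add: homothety_def algebra_simps)
qed

section \<open>Volume and the two mean value bounds for one tetrahedron\<close>

lemma has_integral_pow: "((\<lambda>x::real. x ^ n) has_integral 1 / real (n + 1)) {0..1}"
proof -
  have "((\<lambda>x::real. x ^ Suc n / real (Suc n)) has_real_derivative x ^ n) (at x within {0..1})" for x
    using DERIV_cdivide[OF DERIV_pow[of "Suc n"], where c = "real (Suc n)"]
    by (simp del: of_nat_Suc power_Suc)
  then have "((\<lambda>x::real. x ^ Suc n / real (Suc n)) has_vector_derivative x ^ n) (at x within {0..1})" for x
    unfolding has_real_derivative_iff_has_vector_derivative .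
  from fundamental_theorem_of_calculus[OF _ this] show ?thesis by simp
qed

text \<open>The slicing formula for the constant function \<open>1\<close>: the factor
  \<open>1/6\<close> is \<open>1/3\<close> from the moment of \<open>\<tau>\<^sup>2\<close> times
  the area \<open>1/2\<close> of \<open>std_tri\<close>.\<close>

lemma measure_tetrahedron:
  assumes D: "tet_det P X A B \<noteq> 0"
  shows "measure lebesgue (convex hull {P, X, A, B}) = \<bar>tet_det P X A B\<bar> / 6"
proof -
  have lm: "convex hull {P, X, A, B} \<in> lmeasurable"
    by (intro lmeasurable_compact compact_convex_hull finite_imp_compact) auto
  have "convex_on (convex hull {P, X, A, B}) (\<lambda>_. 1)"
    by (rule convex_onI) auto
  from tetrahedron_integral_slices[OF this D]
  have "((\<lambda>\<tau>. \<tau>\<^sup>2 * (1/2)) has_integral measure lebesgue (convex hull {P, X, A, B}) / \<bar>tet_det P X A B\<bar>) {0..1}"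
    by (simp add: tri_param_integral_def integral_std_tri_const lmeasure_integral[OF lm])
  moreover have "((\<lambda>\<tau>. \<tau>\<^sup>2 * (1/2)) has_integral (1/3 * (1/2) :: real)) {0..1}"
    using has_integral_mult_left[OF has_integral_pow[of 2], of "1/2"] by simp
  ultimately have "measure lebesgue (convex hull {P, X, A, B}) / \<bar>tet_det P X A B\<bar> = 1/3 * (1/2)"
    by (rule has_integral_unique)
  then show ?thesis using D by (simp add: field_simps)
qed

text \<open>The chord of the slice function lies above it. Its moments give
  \<open>\<Psi> 0 / 12 + \<Psi> 1 / 4\<close>, and \<open>\<Psi> 0\<close> is \<open>f P / 2\<close>
  because the slice integral is half a mean.\<close>

lemma tetrahedron_integral_le:
  assumes conv: "convex_on (convex hull {P, X, A, B}) f" and D: "tet_det P X A B \<noteq> 0"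
  shows "integral (convex hull {P, X, A, B}) f
    \<le> \<bar>tet_det P X A B\<bar> * (f P / 24 + tri_param_integral f X A B / 4)"
proof -
  define \<Psi> where "\<Psi> = (\<lambda>\<tau>. tri_param_integral f (homothety P \<tau> X) (homothety P \<tau> A) (homothety P \<tau> B))"
  have cvx: "convex_on {0..1} \<Psi>"
    unfolding \<Psi>_def by (rule convex_on_tri_param_integral_homothety[OF conv])
  have slices: "((\<lambda>\<tau>. \<tau>\<^sup>2 * \<Psi> \<tau>) has_integral
      integral (convex hull {P, X, A, B}) f / \<bar>tet_det P X A B\<bar>) {0..1}"
    unfolding \<Psi>_def by (rule tetrahedron_integral_slices[OF conv D])
  have \<Psi>0: "\<Psi> 0 = f P / 2"
    by (simp add: \<Psi>_def homothety_def tri_param_integral_def integral_std_tri_const)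
  have \<Psi>1: "\<Psi> 1 = tri_param_integral f X A B"
    by (simp add: \<Psi>_def homothety_def)
  have "((\<lambda>\<tau>. \<tau>\<^sup>2 * \<Psi> 0 + \<tau>^3 * (\<Psi> 1 - \<Psi> 0)) has_integral (1/3 * \<Psi> 0 + 1/4 * (\<Psi> 1 - \<Psi> 0))) {0..1}"
    using has_integral_add[OF has_integral_mult_left[OF has_integral_pow[of 2], of "\<Psi> 0"]
      has_integral_mult_left[OF has_integral_pow[of 3], of "\<Psi> 1 - \<Psi> 0"]] by simp
  then have "integral (convex hull {P, X, A, B}) f / \<bar>tet_det P X A B\<bar> \<le> 1/3 * \<Psi> 0 + 1/4 * (\<Psi> 1 - \<Psi> 0)"
  proof (rule has_integral_le[OF slices])
    fix \<tau> :: real assume \<tau>: "\<tau> \<in> {0..1}"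
    have "\<Psi> \<tau> \<le> (1 - \<tau>) * \<Psi> 0 + \<tau> * \<Psi> 1"
      using convex_onD[OF cvx, of \<tau> 0 1] \<tau> by simp
    from mult_left_mono[OF this, of "\<tau>\<^sup>2"]
    show "\<tau>\<^sup>2 * \<Psi> \<tau> \<le> \<tau>\<^sup>2 * \<Psi> 0 + \<tau>^3 * (\<Psi> 1 - \<Psi> 0)"
      by (simp add: algebra_simps power2_eq_square power3_eq_cube)
  qed
  then show ?thesis
    using D \<Psi>0 \<Psi>1 by (simp add: field_simps)
qed

text \<open>The factor \<open>1/3\<close> is the volume factor \<open>1/6\<close> times the
  \<open>2\<close> that turns a parameter integral into a mean.\<close>

lemma tetrahedron_integral_ge:
  assumes conv: "convex_on (convex hull {P, X, A, B}) f" and D: "tet_det P X A B \<noteq> 0"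
  shows "\<bar>tet_det P X A B\<bar> / 3 *
      tri_param_integral f (homothety P (3/4) X) (homothety P (3/4) A) (homothety P (3/4) B)
    \<le> integral (convex hull {P, X, A, B}) f"
proof -
  define \<Psi> where "\<Psi> = (\<lambda>\<tau>. tri_param_integral f (homothety P \<tau> X) (homothety P \<tau> A) (homothety P \<tau> B))"
  have cvx: "convex_on {0..1} \<Psi>"
    unfolding \<Psi>_def by (rule convex_on_tri_param_integral_homothety[OF conv])
  have slices: "((\<lambda>\<tau>. \<tau>\<^sup>2 * \<Psi> \<tau>) has_integral
      integral (convex hull {P, X, A, B}) f / \<bar>tet_det P X A B\<bar>) {0..1}"
    unfolding \<Psi>_def by (rule tetrahedron_integral_slices[OF conv D])
  \<comment> \<open>\<open>3/4\<close> is the barycentre of the density \<open>3\<tau>\<^sup>2\<close>, so the supporting line there integrates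
    to its value at \<open>3/4\<close>.\<close>
  obtain c where c: "\<And>\<tau>. \<tau> \<in> {0..1} \<Longrightarrow> \<Psi> (3/4) + c * (\<tau> - 3/4) \<le> \<Psi> \<tau>"
    using convex_le_Inf_differential[OF cvx, of "3/4"] by (auto simp: interior_atLeastAtMost_real)
  have "((\<lambda>\<tau>. \<tau>\<^sup>2 * (\<Psi> (3/4) - 3/4 * c) + \<tau>^3 * c) has_integral (1/3 * (\<Psi> (3/4) - 3/4 * c) + 1/4 * c)) {0..1}"
    using has_integral_add[OF has_integral_mult_left[OF has_integral_pow[of 2], of "\<Psi> (3/4) - 3/4 * c"]
      has_integral_mult_left[OF has_integral_pow[of 3], of c]] by simp
  then have "1/3 * (\<Psi> (3/4) - 3/4 * c) + 1/4 * c \<le> integral (convex hull {P, X, A, B}) f / \<bar>tet_det P X A B\<bar>"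
  proof (rule has_integral_le[OF _ slices])
    fix \<tau> :: real assume \<tau>: "\<tau> \<in> {0..1}"
    from mult_left_mono[OF c[OF this], of "\<tau>\<^sup>2"]
    show "\<tau>\<^sup>2 * (\<Psi> (3/4) - 3/4 * c) + \<tau>^3 * c \<le> \<tau>\<^sup>2 * \<Psi> \<tau>"
      by (simp add: algebra_simps power2_eq_square power3_eq_cube)
  qed
  then show ?thesis
    using D by (simp add: field_simps \<Psi>_def)
qed

section \<open>Dipyramids over a regular polygon\<close>

lemma convex_hull_4E:
  fixes P X A B :: "real^3"
  assumes "x \<in> convex hull {P, X, A, B}"
  obtains a b c d where "0 \<le> a" "0 \<le> b" "0 \<le> c" "0 \<le> d" "a + b + c + d = 1"
    "x = a *\<^sub>R P + b *\<^sub>R X + c *\<^sub>R A + d *\<^sub>R B"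
proof -
  from assms obtain q :: "real^3" where q: "q$1 \<le> 1" "0 \<le> q$2" "0 \<le> q$3" "q$2 + q$3 \<le> q$1"
    and x: "x = P + q$1 *\<^sub>R (X - P) + q$2 *\<^sub>R (A - X) + q$3 *\<^sub>R (B - X)"
    by (auto simp: convex_hull_4_cone slant_tet_def)
  show ?thesis
    by (rule that[of "1 - q$1" "q$1 - q$2 - q$3" "q$2" "q$3"]) (use q in \<open>auto simp: x algebra_simps\<close>)
qed

lemma lmeasurable_convex_hull_4: "convex hull {P, X, A, B :: real^3} \<in> lmeasurable"
  by (intro lmeasurable_compact compact_convex_hull finite_imp_compact) auto

text \<open>A point with weights \<open>a\<close>, \<open>b\<close> at \<open>X\<close>,
  \<open>Y\<close> belongs to the part at \<open>X\<close> or at \<open>Y\<close> according to how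
  \<open>a : b\<close> compares with \<open>(1 - s) : s\<close>. The vertex with too little weight
  is traded in completely for \<open>Z\<close>.\<close>

lemma convex_hull_4_split:
  fixes X Y A B :: "real^3"
  assumes s: "0 < s" "s < 1" and Z: "Z = (1 - s) *\<^sub>R X + s *\<^sub>R Y"
  shows "convex hull {X, Y, A, B} = convex hull {Z, X, A, B} \<union> convex hull {Z, Y, A, B}"
proof (intro subset_antisym Un_least)
  have "Z \<in> convex hull {X, Y, A, B}"
    using mem_convex_hull_4[of "1 - s" s 0 0 X Y A B] s by (simp add: Z)
  then have "convex hull {Z, V, A, B} \<subseteq> convex hull {X, Y, A, B}" if "V \<in> {X, Y}" for V
    using that by (intro hull_minimal) (auto simp: hull_inc)
  then show "convex hull {Z, X, A, B} \<subseteq> convex hull {X, Y, A, B}"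
    and "convex hull {Z, Y, A, B} \<subseteq> convex hull {X, Y, A, B}"
    by simp_all
  show "convex hull {X, Y, A, B} \<subseteq> convex hull {Z, X, A, B} \<union> convex hull {Z, Y, A, B}"
  proof
    fix x assume "x \<in> convex hull {X, Y, A, B}"
    then obtain a b c d where nn: "0 \<le> a" "0 \<le> b" "0 \<le> c" "0 \<le> d" and sm: "a + b + c + d = 1"
      and x: "x = a *\<^sub>R X + b *\<^sub>R Y + c *\<^sub>R A + d *\<^sub>R B"
      by (rule convex_hull_4E)
    show "x \<in> convex hull {Z, X, A, B} \<union> convex hull {Z, Y, A, B}"
    proof (cases "b * (1 - s) \<le> a * s")
      case True
      have "b / s * (1 - s) \<le> a"
        using True s by (simp add: field_simps)
      moreover have "b / s + (a - b / s * (1 - s)) = a + b"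
        using s by (simp add: field_simps)
      ultimately have "(b / s) *\<^sub>R Z + (a - b / s * (1 - s)) *\<^sub>R X + c *\<^sub>R A + d *\<^sub>R B
          \<in> convex hull {Z, X, A, B}"
        using nn sm s by (intro mem_convex_hull_4) auto
      moreover have "(b / s) *\<^sub>R Z = (b / s * (1 - s)) *\<^sub>R X + b *\<^sub>R Y"
        using s by (simp add: Z scaleR_add_right)
      ultimately show ?thesis
        by (simp add: x algebra_simps)
    next
      case False
      have "a / (1 - s) * s \<le> b"
        using False s by (simp add: field_simps)
      moreover have "a / (1 - s) * (1 - s) = a"
        using s by simp
      then have "a / (1 - s) + (b - a / (1 - s) * s) = a + b"
        unfolding Rings.right_diff_distrib by linarith
      ultimately have "(a / (1 - s)) *\<^sub>R Z + (b - a / (1 - s) * s) *\<^sub>R Y + c *\<^sub>R A + d *\<^sub>R B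
          \<in> convex hull {Z, Y, A, B}"
        using nn sm s by (intro mem_convex_hull_4) auto
      moreover have "(a / (1 - s)) *\<^sub>R Z = a *\<^sub>R X + (a / (1 - s) * s) *\<^sub>R Y"
        using s by (simp add: Z scaleR_add_right)
      ultimately show ?thesis
        by (simp add: x algebra_simps)
    qed
  qed
qed

text \<open>Replacing the apex by \<open>Z\<close> changes the other two edge vectors only by
  multiples of \<open>Y - X\<close>, which drop out of the determinant. The remaining edge is scaled
  by \<open>-s\<close> or \<open>1 - s\<close>.\<close>

lemma tet_det_split:
  assumes "Z = (1 - s) *\<^sub>R X + s *\<^sub>R Y"
  shows "tet_det Z X A B = - (s * tet_det X Y A B)" "tet_det Z Y A B = (1 - s) * tet_det X Y A B"
  unfolding assms tet_det_def by (simp_all add: cross3_def inner_vec_def sum_3 algebra_simps)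

lemma negligible_convex_hull_4_split:
  assumes s: "0 < s" "s < 1" and Z: "Z = (1 - s) *\<^sub>R X + s *\<^sub>R Y"
    and D: "tet_det X Y A B \<noteq> 0"
  shows "negligible (convex hull {Z, X, A, B} \<inter> convex hull {Z, Y, A, B})"
proof -
  \<comment> \<open>The volumes of the two parts add up to the volume of the whole.\<close>
  have "measure lebesgue (convex hull {Z, X, A, B}) = s * \<bar>tet_det X Y A B\<bar> / 6"
    using measure_tetrahedron[of Z X A B] D s by (simp add: tet_det_split(1)[OF Z] abs_mult)
  moreover have "measure lebesgue (convex hull {Z, Y, A, B}) = (1 - s) * \<bar>tet_det X Y A B\<bar> / 6"
    using measure_tetrahedron[of Z Y A B] D s by (simp add: tet_det_split(2)[OF Z] abs_mult)
  moreover note measure_tetrahedron[OF D]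
    measure_Un3[OF lmeasurable_convex_hull_4 lmeasurable_convex_hull_4, of Z X A B Z Y A B]
  ultimately have "measure lebesgue (convex hull {Z, X, A, B} \<inter> convex hull {Z, Y, A, B}) = 0"
    by (simp add: convex_hull_4_split[OF s Z, symmetric] algebra_simps)
  then show ?thesis
    by (simp add: negligible_iff_measure fmeasurable.Int lmeasurable_convex_hull_4)
qed

lemma integral_convex_hull_4_split:
  assumes s: "0 < s" "s < 1" and Z: "Z = (1 - s) *\<^sub>R X + s *\<^sub>R Y"
    and D: "tet_det X Y A B \<noteq> 0" and conv: "convex_on (convex hull {X, Y, A, B}) f"
  shows "integral (convex hull {X, Y, A, B}) f =
    integral (convex hull {Z, X, A, B}) f + integral (convex hull {Z, Y, A, B}) f"
  unfolding convex_hull_4_split[OF s Z]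
proof (rule integral_Un[OF _ _ negligible_convex_hull_4_split[OF s Z D]])
  have "f integrable_on (convex hull V)"
    if "finite V" "convex hull V \<subseteq> convex hull {X, Y, A, B}" for V
    using convex_on_polytope_absolutely_integrable[OF that(1) convex_on_subset[OF conv that(2)]]
    by (simp add: absolutely_integrable_on_def)
  then show "f integrable_on (convex hull {Z, X, A, B})" "f integrable_on (convex hull {Z, Y, A, B})"
    by (simp_all add: convex_hull_4_split[OF s Z])
qed

text \<open>A common area element \<open>c\<close> factors out of both sums and cancels in the
  average, leaving \<open>2/n\<close> times the sum of the parameter integrals.\<close>

lemma surf_sums_equal_area:
  assumes "\<And>k. k < n \<Longrightarrow> norm (cross3 (a k - x k) (b k - x k)) = c"
  shows "(\<Sum>T\<leftarrow>map (\<lambda>k. (x k, a k, b k)) [0..<n]. tri_integral f T) =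
      c * (\<Sum>k<n. tri_param_integral f (x k) (a k) (b k))" (is ?int)
    and "(\<Sum>T\<leftarrow>map (\<lambda>k. (x k, a k, b k)) [0..<n]. tri_area T) = real n * c / 2" (is ?area)
proof -
  have "(\<Sum>T\<leftarrow>map (\<lambda>k. (x k, a k, b k)) [0..<n]. tri_integral f T) =
      (\<Sum>k<n. tri_param_integral f (x k) (a k) (b k) * c)"
    by (simp add: comp_def interv_sum_list_conv_sum_set_nat atLeast0LessThan
        tri_integral_def tri_param_integral_def assms)
  then show ?int
    by (simp add: sum_distrib_left mult.commute)
  show ?area
    by (simp add: comp_def interv_sum_list_conv_sum_set_nat atLeast0LessThan tri_area_def assms)
qed

section \<open>The regular polygon and its axis: volumes, face areas and angles\<close>

locale regular_polygon =
  fixes C u v :: "real^3" and A :: "nat \<Rightarrow> real^3" and n :: nat and r \<theta> :: real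
  assumes n: "n \<ge> 3"
    and uv: "norm u = 1" "norm v = 1" "u \<bullet> v = 0"
    and r: "r > 0"
    and A: "\<And>k. A k = C + (r * cos (\<theta> + 2 * pi * real k / real n)) *\<^sub>R u
                         + (r * sin (\<theta> + 2 * pi * real k / real n)) *\<^sub>R v"
begin

abbreviation w where "w \<equiv> cross3 u v"

definition \<alpha> :: "nat \<Rightarrow> real" where "\<alpha> k = \<theta> + 2 * pi * real k / real n"

definition \<delta> :: real where "\<delta> = 2 * pi / real n"

text \<open>The radial direction of \<open>A k\<close> turned by a right angle: a unit normal of the
  plane through \<open>l\<close> and \<open>A k\<close>, pointing towards larger angles.\<close>

definition wall_normal :: "nat \<Rightarrow> real^3" where "wall_normal k = cos (\<alpha> k) *\<^sub>R v - sin (\<alpha> k) *\<^sub>R u"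

lemma A_eq: "A k = C + r *\<^sub>R (cos (\<alpha> k) *\<^sub>R u + sin (\<alpha> k) *\<^sub>R v)"
  by (simp add: A \<alpha>_def scaleR_add_right)

lemma \<alpha>_diff: "\<alpha> j - \<alpha> i = (real j - real i) * \<delta>"
  by (simp add: \<alpha>_def \<delta>_def diff_divide_distrib algebra_simps)

lemma n_\<delta>: "real n * \<delta> = 2 * pi"
  using n by (simp add: \<delta>_def)

text \<open>With at least three vertices the central angle lies strictly between \<open>0\<close>
  and \<open>pi\<close>. All nondegeneracy below rests on this.\<close>

lemma sin_\<delta>_pos: "sin \<delta> > 0"
proof (rule sin_gt_zero)
  show "0 < \<delta>" using n by (simp add: \<delta>_def)
  show "\<delta> < pi" using n by (simp add: \<delta>_def field_simps)
qed

lemma inner_uvw: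
  "u \<bullet> u = 1" "v \<bullet> v = 1" "u \<bullet> v = 0" "v \<bullet> u = 0" "w \<bullet> w = 1"
  "w \<bullet> u = 0" "w \<bullet> v = 0" "u \<bullet> w = 0" "v \<bullet> w = 0"
proof -
  show "w \<bullet> w = 1"
    using norm_cross[of u v] uv by (simp add: power2_norm_eq_inner)
qed (use uv in \<open>auto simp: norm_eq_1 inner_commute dot_cross_self\<close>)

lemma norm_w: "norm w = 1"
  by (simp add: norm_eq_1 inner_uvw)

text \<open>This is twice the area of the projection of a face to the plane of the polygon, so
  neither \<open>k\<close> nor the height \<open>z\<close> of the apex enters.\<close>

lemma inner_w_cross:
  "w \<bullet> cross3 (A k - (C + z *\<^sub>R w)) (A (Suc k) - (C + z *\<^sub>R w)) = r\<^sup>2 * sin \<delta>"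
proof -
  have "\<delta> = \<alpha> (Suc k) - \<alpha> k"
    by (simp add: \<alpha>_diff)
  then have sd: "sin \<delta> = sin (\<alpha> (Suc k)) * cos (\<alpha> k) - cos (\<alpha> (Suc k)) * sin (\<alpha> k)"
    by (simp add: sin_diff)
  have skew: "cross3 v u = - w"
    by (rule cross_skew)
  have ww: "w \<bullet> cross3 w x = 0" "w \<bullet> cross3 x w = 0" for x
    by (simp_all add: dot_cross_self)
  show ?thesis
    unfolding A_eq sd
    by (simp add: cross_add_left cross_add_right cross_mult_left cross_mult_right Cross3.left_diff_distrib
        Cross3.right_diff_distrib skew inner_add_right inner_diff_right inner_uvw ww algebra_simps power2_eq_square)
qed

lemma tet_det_axis:
  "tet_det (C + z *\<^sub>R w) (C + y *\<^sub>R w) (A k) (A (Suc k)) = (y - z) * (r\<^sup>2 * sin \<delta>)"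
proof -
  have "(C + y *\<^sub>R w) - (C + z *\<^sub>R w) = (y - z) *\<^sub>R w"
    by (simp add: algebra_simps)
  then show ?thesis
    by (simp add: tet_det_def inner_w_cross)
qed

text \<open>Twice the area of a face with apex at height \<open>z\<close>, by Lagrange's identity:
  both lateral edges have squared length \<open>r\<^sup>2 + z\<^sup>2\<close>, and their inner
  product is \<open>r\<^sup>2 * cos \<delta> + z\<^sup>2\<close>.\<close>

definition face_cross :: "real \<Rightarrow> real" where
  "face_cross z = sqrt ((r\<^sup>2 + z\<^sup>2)\<^sup>2 - (r\<^sup>2 * cos \<delta> + z\<^sup>2)\<^sup>2)"

lemma norm_cross_face:
  "norm (cross3 (A k - (C + z *\<^sub>R w)) (A (Suc k) - (C + z *\<^sub>R w))) = face_cross z"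
proof -
  have "\<delta> = \<alpha> (Suc k) - \<alpha> k"
    by (simp add: \<alpha>_diff)
  then have cd: "cos \<delta> = cos (\<alpha> (Suc k)) * cos (\<alpha> k) + sin (\<alpha> (Suc k)) * sin (\<alpha> k)"
    by (simp add: cos_diff)
  have sq: "(norm (A k - (C + z *\<^sub>R w)))\<^sup>2 = r\<^sup>2 + z\<^sup>2" for k
  proof -
    have "(norm (A k - (C + z *\<^sub>R w)))\<^sup>2 = r\<^sup>2 * (cos (\<alpha> k))\<^sup>2 + r\<^sup>2 * (sin (\<alpha> k))\<^sup>2 + z\<^sup>2"
      unfolding power2_norm_eq_inner A_eq
      by (simp add: inner_add_left inner_add_right inner_diff_left inner_diff_right inner_uvw
          algebra_simps power2_eq_square)
    then show ?thesis by (simp flip: distrib_left)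
  qed
  have ip: "(A k - (C + z *\<^sub>R w)) \<bullet> (A (Suc k) - (C + z *\<^sub>R w)) = r\<^sup>2 * cos \<delta> + z\<^sup>2"
    unfolding A_eq cd
    by (simp add: inner_add_left inner_add_right inner_diff_left inner_diff_right inner_uvw
        algebra_simps power2_eq_square)
  have "(norm (cross3 (A k - (C + z *\<^sub>R w)) (A (Suc k) - (C + z *\<^sub>R w))))\<^sup>2 =
      (r\<^sup>2 + z\<^sup>2)\<^sup>2 - (r\<^sup>2 * cos \<delta> + z\<^sup>2)\<^sup>2"
    unfolding norm_cross sq ip by (simp add: power2_eq_square)
  then show ?thesis
    unfolding face_cross_def by (metis norm_ge_zero real_sqrt_unique)
qed

lemma face_pos: "face_cross z > 0"
proof -
  have "cross3 (A 0 - (C + z *\<^sub>R w)) (A (Suc 0) - (C + z *\<^sub>R w)) \<noteq> 0"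
    using inner_w_cross[of 0 z] sin_\<delta>_pos r by auto
  then show ?thesis
    using norm_cross_face[of 0 z] by (metis zero_less_norm_iff)
qed

text \<open>The sine is the ratio of projected to actual face area. Cauchy-Schwarz keeps this ratio
  in the range where \<open>sin\<close> undoes \<open>arcsin\<close>.\<close>

lemma sin_angle_face:
  "sin (angle_line_plane w (C + z *\<^sub>R w) (A 0) (A 1)) = r\<^sup>2 * sin \<delta> / face_cross z"
proof -
  let ?N = "cross3 (A 0 - (C + z *\<^sub>R w)) (A (Suc 0) - (C + z *\<^sub>R w))"
  have "\<bar>w \<bullet> ?N\<bar> / (norm w * norm ?N) = r\<^sup>2 * sin \<delta> / face_cross z"
    using sin_\<delta>_pos by (simp add: inner_w_cross norm_cross_face norm_w)
  moreover have "\<bar>w \<bullet> ?N\<bar> / (norm w * norm ?N) \<le> 1"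
    using Cauchy_Schwarz_ineq2[of w ?N] by (simp add: divide_le_eq_1 norm_w)
  moreover have "-1 \<le> r\<^sup>2 * sin \<delta> / face_cross z"
    using sin_\<delta>_pos face_pos[of z] by (intro order_trans[OF _ divide_nonneg_nonneg]) auto
  ultimately show ?thesis
    by (simp add: angle_line_plane_def Let_def)
qed

text \<open>The normal is orthogonal to the axis and the weights sum to one, so only the polygon
  vertices contribute, each with the sine of its angle from the wall.\<close>

lemma inner_e:
  "wall_normal k \<bullet> (a *\<^sub>R (C + x *\<^sub>R w) + b *\<^sub>R (C + y *\<^sub>R w) + c *\<^sub>R A i + d *\<^sub>R A j - C) =
    r * (c * sin (\<alpha> i - \<alpha> k) + d * sin (\<alpha> j - \<alpha> k))" if "a + b + c + d = 1"
proof -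
  have C: "a *\<^sub>R C + b *\<^sub>R C + c *\<^sub>R C + d *\<^sub>R C = C"
    using that by (simp add: scaleR_left_distrib[symmetric])
  have eq: "a *\<^sub>R (C + x *\<^sub>R w) + b *\<^sub>R (C + y *\<^sub>R w) + c *\<^sub>R A i + d *\<^sub>R A j - C =
     (a * x + b * y) *\<^sub>R w + (c * r) *\<^sub>R (cos (\<alpha> i) *\<^sub>R u + sin (\<alpha> i) *\<^sub>R v)
       + (d * r) *\<^sub>R (cos (\<alpha> j) *\<^sub>R u + sin (\<alpha> j) *\<^sub>R v)
       + (a *\<^sub>R C + b *\<^sub>R C + c *\<^sub>R C + d *\<^sub>R C - C)"
    unfolding A_eq by (simp add: algebra_simps)
  show ?thesis
    unfolding eq C wall_normal_def
    by (simp add: inner_add_right inner_diff_left inner_uvw sin_diff algebra_simps)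
qed

text \<open>The sign of the inner product with \<open>wall_normal k\<close> tells on which side of the plane through \<open>l\<close>
  and \<open>A k\<close> a point lies; a common point of the \<open>i\<close>-th and \<open>j\<close>-th tetrahedron must lie on one of
  the two planes bounding the \<open>j\<close>-th wedge.\<close>

lemma negligible_tetrahedra_Int:
  assumes ij: "i < j" "j < n"
  shows "negligible (convex hull {C + x *\<^sub>R w, C + y *\<^sub>R w, A i, A (Suc i)} \<inter>
    convex hull {C + x *\<^sub>R w, C + y *\<^sub>R w, A j, A (Suc j)})" (is "negligible (?T i \<inter> ?T j)")
proof (rule negligible_subset)
  have wall_normal: "wall_normal k \<noteq> 0" for k
  proof
    assume "wall_normal k = 0"
    then have "wall_normal k \<bullet> wall_normal k = 0" by simp
    moreover have "wall_normal k \<bullet> wall_normal k = 1"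
      by (simp add: wall_normal_def inner_diff_left inner_diff_right inner_uvw flip: power2_eq_square)
    ultimately show False by simp
  qed
  have "negligible {p. wall_normal k \<bullet> p = wall_normal k \<bullet> C}" for k
    by (rule negligible_hyperplane) (use wall_normal in auto)
  then show "negligible ({p. wall_normal j \<bullet> p = wall_normal j \<bullet> C} \<union> {p. wall_normal (Suc j) \<bullet> p = wall_normal (Suc j) \<bullet> C})"
    by (intro negligible_Un)
  show "?T i \<inter> ?T j \<subseteq> {p. wall_normal j \<bullet> p = wall_normal j \<bullet> C} \<union> {p. wall_normal (Suc j) \<bullet> p = wall_normal (Suc j) \<bullet> C}"
  proof
    fix p assume "p \<in> ?T i \<inter> ?T j"
    then have pi: "p \<in> ?T i" and pj: "p \<in> ?T j" by auto
    from pj obtain a' b' c' d' where j: "0 \<le> c'" "0 \<le> d'" "a' + b' + c' + d' = 1"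
      "p = a' *\<^sub>R (C + x *\<^sub>R w) + b' *\<^sub>R (C + y *\<^sub>R w) + c' *\<^sub>R A j + d' *\<^sub>R A (Suc j)"
      by (rule convex_hull_4E)
    have "wall_normal j \<bullet> (p - C) = r * (d' * sin \<delta>)" "wall_normal (Suc j) \<bullet> (p - C) = - (r * (c' * sin \<delta>))"
      unfolding j(4) inner_e[OF j(3)] \<alpha>_diff by simp_all
    then have pj: "wall_normal j \<bullet> (p - C) \<ge> 0" "wall_normal (Suc j) \<bullet> (p - C) \<le> 0"
      using r j sin_\<delta>_pos by simp_all
    from pi obtain a b c d where i: "0 \<le> c" "0 \<le> d" "a + b + c + d = 1"
      "p = a *\<^sub>R (C + x *\<^sub>R w) + b *\<^sub>R (C + y *\<^sub>R w) + c *\<^sub>R A i + d *\<^sub>R A (Suc i)"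
      by (rule convex_hull_4E)
    \<comment> \<open>The number of wedges strictly between the \<open>i\<close>-th and the
      \<open>j\<close>-th. The subtraction is exact since \<open>i < j\<close>.\<close>
    define m where "m = j - i - 1"
    have jm: "real j = real i + 1 + real m" "Suc (Suc m) \<le> n"
      using ij by (auto simp: m_def)
    have \<phi>: "wall_normal j \<bullet> (p - C) = - (r * (c * sin ((real m + 1) * \<delta>) + d * sin (real m * \<delta>)))"
        "wall_normal (Suc j) \<bullet> (p - C) = - (r * (c * sin ((real m + 2) * \<delta>) + d * sin ((real m + 1) * \<delta>)))"
    proof -
      have neg: "(real i - real j) * \<delta> = - ((real m + 1) * \<delta>)"
          "(real (Suc i) - real j) * \<delta> = - (real m * \<delta>)"
          "(real i - real (Suc j)) * \<delta> = - ((real m + 2) * \<delta>)"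
          "(real (Suc i) - real (Suc j)) * \<delta> = - ((real m + 1) * \<delta>)"
        by (simp_all add: jm(1) algebra_simps)
      show "wall_normal j \<bullet> (p - C) = - (r * (c * sin ((real m + 1) * \<delta>) + d * sin (real m * \<delta>)))"
        "wall_normal (Suc j) \<bullet> (p - C) = - (r * (c * sin ((real m + 2) * \<delta>) + d * sin ((real m + 1) * \<delta>)))"
        unfolding i(4) inner_e[OF i(3)] \<alpha>_diff neg sin_minus by (simp_all add: algebra_simps)
    qed
    have \<delta>: "\<delta> > 0" using n by (simp add: \<delta>_def)
    \<comment> \<open>The wedges \<open>i\<close> to \<open>j\<close> number \<open>m + 2\<close>
      and are among the \<open>n\<close> wedges, so together they span at most one full
      turn.\<close>
    have top: "(real m + 2) * \<delta> \<le> 2 * pi"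
      unfolding n_\<delta>[symmetric] using jm(2) \<delta> by (intro mult_right_mono) auto
    have step: "real m * \<delta> \<le> (real m + 1) * \<delta>" "(real m + 1) * \<delta> < (real m + 2) * \<delta>" "0 \<le> real m * \<delta>"
      using \<delta> by (simp_all add: algebra_simps)
    \<comment> \<open>If \<open>A i\<close> is at most half a turn behind \<open>A j\<close>, the
      \<open>i\<close>-th tetrahedron lies behind wall \<open>j\<close>; otherwise it lies beyond
      wall \<open>Suc j\<close>. Either way it is opposite the \<open>j\<close>-th one, up to the
      wall itself.\<close>
    have "wall_normal j \<bullet> (p - C) \<le> 0 \<or> wall_normal (Suc j) \<bullet> (p - C) \<ge> 0"
    proof (cases "(real m + 1) * \<delta> \<le> pi")
      case True
      then have "sin ((real m + 1) * \<delta>) \<ge> 0" "sin (real m * \<delta>) \<ge> 0"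
        using step by (auto intro!: sin_ge_zero)
      then have "wall_normal j \<bullet> (p - C) \<le> 0"
        unfolding \<phi> using r i by simp
      then show ?thesis ..
    next
      case False
      have le: "sin t \<le> 0" if "pi \<le> t" "t \<le> 2 * pi" for t
        using sin_ge_zero[of "t - pi"] that by (simp add: sin_diff)
      have "sin ((real m + 1) * \<delta>) \<le> 0" "sin ((real m + 2) * \<delta>) \<le> 0"
        using step top False by (auto intro!: le)
      then have "c * sin ((real m + 2) * \<delta>) + d * sin ((real m + 1) * \<delta>) \<le> 0"
        using i by (intro add_nonpos_nonpos mult_nonneg_nonpos) auto
      then have "wall_normal (Suc j) \<bullet> (p - C) \<ge> 0"
        unfolding \<phi> using r by (simp add: mult_nonneg_nonpos)
      then show ?thesis ..
    qed
    with pj have "wall_normal j \<bullet> (p - C) = 0 \<or> wall_normal (Suc j) \<bullet> (p - C) = 0" by auto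
    then show "p \<in> {p. wall_normal j \<bullet> p = wall_normal j \<bullet> C} \<union> {p. wall_normal (Suc j) \<bullet> p = wall_normal (Suc j) \<bullet> C}"
      by (auto simp: inner_diff_right)
  qed
qed

lemma integral_dipyramid:
  assumes "\<And>k. k < n \<Longrightarrow> convex_on (convex hull {C + x *\<^sub>R w, C + y *\<^sub>R w, A k, A (Suc k)}) f"
  shows "integral (dipyramid (C + x *\<^sub>R w) (C + y *\<^sub>R w) A n) f =
    (\<Sum>k<n. integral (convex hull {C + x *\<^sub>R w, C + y *\<^sub>R w, A k, A (Suc k)}) f)"
  unfolding dipyramid_def
proof (rule integral_unique, rule has_integral_UN)
  fix k assume "k \<in> {..<n}"
  then have "f absolutely_integrable_on (convex hull {C + x *\<^sub>R w, C + y *\<^sub>R w, A k, A (Suc k)})"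
    using assms by (intro convex_on_polytope_absolutely_integrable) auto
  then show "(f has_integral integral (convex hull {C + x *\<^sub>R w, C + y *\<^sub>R w, A k, A (Suc k)}) f)
      (convex hull {C + x *\<^sub>R w, C + y *\<^sub>R w, A k, A (Suc k)})"
    by (simp add: absolutely_integrable_on_def integrable_integral)
next
  show "pairwise (\<lambda>i j. negligible (convex hull {C + x *\<^sub>R w, C + y *\<^sub>R w, A i, A (Suc i)} \<inter>
     convex hull {C + x *\<^sub>R w, C + y *\<^sub>R w, A j, A (Suc j)})) {..<n}"
    unfolding pairwise_def using negligible_tetrahedra_Int
    by (metis Int_commute lessThan_iff linorder_neqE_nat)
qed auto

lemma measure_dipyramid:
  assumes "x \<noteq> y"
  shows "measure lebesgue (dipyramid (C + x *\<^sub>R w) (C + y *\<^sub>R w) A n) = real n * (\<bar>x - y\<bar> * (r\<^sup>2 * sin \<delta>)) / 6"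
proof -
  have D: "\<bar>tet_det (C + x *\<^sub>R w) (C + y *\<^sub>R w) (A k) (A (Suc k))\<bar> = \<bar>x - y\<bar> * (r\<^sup>2 * sin \<delta>)" for k
    using sin_\<delta>_pos by (simp add: tet_det_axis abs_mult abs_minus_commute)
  have Dnz: "tet_det (C + x *\<^sub>R w) (C + y *\<^sub>R w) (A k) (A (Suc k)) \<noteq> 0" for k
    using assms sin_\<delta>_pos r by (simp add: tet_det_axis)
  have "dipyramid (C + x *\<^sub>R w) (C + y *\<^sub>R w) A n \<in> lmeasurable"
    unfolding dipyramid_def by (intro fmeasurable.finite_UN) (auto simp: lmeasurable_convex_hull_4)
  then have "measure lebesgue (dipyramid (C + x *\<^sub>R w) (C + y *\<^sub>R w) A n) =
      integral (dipyramid (C + x *\<^sub>R w) (C + y *\<^sub>R w) A n) (\<lambda>_. 1)"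
    by (rule lmeasure_integral)
  also have "\<dots> = (\<Sum>k<n. integral (convex hull {C + x *\<^sub>R w, C + y *\<^sub>R w, A k, A (Suc k)}) (\<lambda>_. 1))"
    by (rule integral_dipyramid) (rule convex_onI, auto)
  also have "\<dots> = (\<Sum>k<n. \<bar>x - y\<bar> * (r\<^sup>2 * sin \<delta>) / 6)"
    by (simp add: lmeasure_integral[OF lmeasurable_convex_hull_4, symmetric] measure_tetrahedron[OF Dnz] D)
  finally show ?thesis by simp
qed

end

section \<open>Summation over the sides and comparison of weights\<close>

theorem theorem7p2:
  fixes C u v O0 O1 :: "real^3" and A :: "nat \<Rightarrow> real^3"
    and n :: nat and r \<theta> t0 t1 s :: real and f :: "real^3 \<Rightarrow> real"
  assumes n: "n \<ge> 3"
    and uv: "norm u = 1" "norm v = 1" "u \<bullet> v = 0"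
    and r: "r > 0"
    and A: "\<And>k. A k = C + (r * cos (\<theta> + 2 * pi * real k / real n)) *\<^sub>R u
                         + (r * sin (\<theta> + 2 * pi * real k / real n)) *\<^sub>R v"
    and O0: "O0 = C + t0 *\<^sub>R cross3 u v" and O1: "O1 = C + t1 *\<^sub>R cross3 u v"
    and t: "t0 \<noteq> 0" "t1 \<noteq> 0" "t0 \<noteq> t1"
    and conv: "\<And>k. k < n \<Longrightarrow> convex_on (convex hull {O0, O1, A k, A (Suc k)}) f"
    and s: "0 < s" "s < 1"
  shows
   "let Os = (1 - s) *\<^sub>R O0 + s *\<^sub>R O1;
        h = homothety Os (3/4);
        D = dipyramid O0 O1 A n;
        \<eta>0 = angle_line_plane (cross3 u v) O0 (A 0) (A 1);
        \<eta>1 = angle_line_plane (cross3 u v) O1 (A 0) (A 1)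
    in vol_avg f D \<le> 1/4 * f Os
         + 3/4 * (s * surf_avg f (umbrella O0 A n) + (1 - s) * surf_avg f (umbrella O1 A n))
     \<and> s * surf_avg f (map_surf h (umbrella O0 A n))
         + (1 - s) * surf_avg f (map_surf h (umbrella O1 A n)) \<le> vol_avg f D
     \<and> surf_avg f (map_surf h (dipyramid_boundary O0 O1 A n))
         \<le> sin \<eta>1 / (sin \<eta>0 + sin \<eta>1) * vol_avg f (dipyramid O0 Os A n)
           + sin \<eta>0 / (sin \<eta>0 + sin \<eta>1) * vol_avg f (dipyramid O1 Os A n)"
proof -
  interpret regular_polygon C u v A n r \<theta>
    by unfold_locales (use n uv r A in auto)
  define Os where "Os = (1 - s) *\<^sub>R O0 + s *\<^sub>R O1"
  define h where "h = homothety Os (3/4)"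
  \<comment> \<open>\<open>G\<close> is twice the projected area of any face, and \<open>K\<close>
    is six times the volume of each tetrahedron
    \<open>O0 O1 A\<^sub>k A\<^sub>k\<^sub>+\<^sub>1\<close>.\<close>
  define G where "G = r\<^sup>2 * sin \<delta>"
  define K where "K = \<bar>t0 - t1\<bar> * G"
  have G: "G > 0"
    using r sin_\<delta>_pos by (simp add: G_def)
  have K: "K > 0"
    using G t by (simp add: K_def)
  have npos: "real n > 0"
    using n by simp
  define ts where "ts = (1 - s) * t0 + s * t1"
  have Os: "Os = C + ts *\<^sub>R w"
    by (simp add: Os_def O0 O1 ts_def algebra_simps)
  have ts: "t0 - ts = s * (t0 - t1)" "t1 - ts = - ((1 - s) * (t0 - t1))"
    by (simp_all add: ts_def algebra_simps)
  have ts_neq: "t0 \<noteq> ts" "t1 \<noteq> ts"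
    using ts s t by auto
  have det: "tet_det O0 O1 (A k) (A (Suc k)) \<noteq> 0"
      "\<bar>tet_det Os O0 (A k) (A (Suc k))\<bar> = s * K" "\<bar>tet_det Os O1 (A k) (A (Suc k))\<bar> = (1 - s) * K" for k
    unfolding O0 O1 Os tet_det_axis ts G_def[symmetric] using t G s by (auto simp: abs_mult K_def)
  have det0: "tet_det Os O0 (A k) (A (Suc k)) \<noteq> 0" "tet_det Os O1 (A k) (A (Suc k)) \<noteq> 0" for k
    using det(2,3)[of k] s K by auto

  have sub: "convex hull {Os, O0, A k, A (Suc k)} \<subseteq> convex hull {O0, O1, A k, A (Suc k)}"
      "convex hull {Os, O1, A k, A (Suc k)} \<subseteq> convex hull {O0, O1, A k, A (Suc k)}" for k
    unfolding convex_hull_4_split[OF s Os_def] by auto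
  have conv0: "convex_on (convex hull {Os, O0, A k, A (Suc k)}) f" if "k < n" for k
    using convex_on_subset[OF conv[OF that] sub(1)] by simp
  have conv1: "convex_on (convex hull {Os, O1, A k, A (Suc k)}) f" if "k < n" for k
    using convex_on_subset[OF conv[OF that] sub(2)] by simp

  \<comment> \<open>For an umbrella vertex \<open>X\<close>: \<open>I\<close> collects the
    tetrahedra with apex \<open>Os\<close>, \<open>S\<close> their bases, and \<open>H\<close> the
    slices of ratio \<open>3/4\<close>.\<close>
  define I where "I = (\<lambda>X. \<Sum>k<n. integral (convex hull {Os, X, A k, A (Suc k)}) f)"
  define S where "S = (\<lambda>X. \<Sum>k<n. tri_param_integral f X (A k) (A (Suc k)))"
  define H where "H = (\<lambda>X. \<Sum>k<n. tri_param_integral f (h X) (h (A k)) (h (A (Suc k))))"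

  have I_le: "I O0 \<le> s * K * (real n * f Os / 24 + S O0 / 4)"
      "I O1 \<le> (1 - s) * K * (real n * f Os / 24 + S O1 / 4)"
  proof -
    have "I O0 \<le> (\<Sum>k<n. s * K * (f Os / 24 + tri_param_integral f O0 (A k) (A (Suc k)) / 4))"
      unfolding I_def
      by (rule sum_mono) (metis tetrahedron_integral_le[OF conv0 det0(1)] det(2) lessThan_iff)
    then show "I O0 \<le> s * K * (real n * f Os / 24 + S O0 / 4)"
      by (simp add: S_def sum.distrib sum_distrib_left[symmetric] sum_divide_distrib[symmetric])
    have "I O1 \<le> (\<Sum>k<n. (1 - s) * K * (f Os / 24 + tri_param_integral f O1 (A k) (A (Suc k)) / 4))"
      unfolding I_def
      by (rule sum_mono) (metis tetrahedron_integral_le[OF conv1 det0(2)] det(3) lessThan_iff)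
    then show "I O1 \<le> (1 - s) * K * (real n * f Os / 24 + S O1 / 4)"
      by (simp add: S_def sum.distrib sum_distrib_left[symmetric] sum_divide_distrib[symmetric])
  qed
  have I_ge: "s * K / 3 * H O0 \<le> I O0" "(1 - s) * K / 3 * H O1 \<le> I O1"
  proof -
    show "s * K / 3 * H O0 \<le> I O0"
      unfolding I_def H_def h_def sum_distrib_left
      by (rule sum_mono) (metis tetrahedron_integral_ge[OF conv0 det0(1)] det(2) lessThan_iff)
    show "(1 - s) * K / 3 * H O1 \<le> I O1"
      unfolding I_def H_def h_def sum_distrib_left
      by (rule sum_mono) (metis tetrahedron_integral_ge[OF conv1 det0(2)] det(3) lessThan_iff)
  qed

  have volD: "vol_avg f (dipyramid O0 O1 A n) = (I O0 + I O1) / (real n * K / 6)"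
  proof -
    have "integral (dipyramid O0 O1 A n) f = (\<Sum>k<n. integral (convex hull {O0, O1, A k, A (Suc k)}) f)"
      unfolding O0 O1 by (rule integral_dipyramid) (use conv in \<open>simp add: O0 O1\<close>)
    also have "\<dots> = I O0 + I O1"
      unfolding I_def sum.distrib[symmetric]
      by (rule sum.cong[OF refl]) (use integral_convex_hull_4_split[OF s Os_def det(1)] conv in auto)
    finally have "integral (dipyramid O0 O1 A n) f = I O0 + I O1" .
    moreover have "measure lebesgue (dipyramid O0 O1 A n) = real n * K / 6"
      unfolding O0 O1 K_def G_def by (rule measure_dipyramid[OF t(3)])
    ultimately show ?thesis
      by (simp only: vol_avg_def)
  qed
  have vol0: "vol_avg f (dipyramid O0 Os A n) = I O0 / (real n * (s * K) / 6)"
  proof -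
    have "integral (dipyramid O0 Os A n) f = (\<Sum>k<n. integral (convex hull {O0, Os, A k, A (Suc k)}) f)"
      unfolding O0 Os by (rule integral_dipyramid) (use conv0 in \<open>simp add: O0 Os insert_commute\<close>)
    moreover have "measure lebesgue (dipyramid O0 Os A n) = real n * (s * K) / 6"
      unfolding O0 Os using s by (simp add: measure_dipyramid[OF ts_neq(1)] ts abs_mult K_def G_def)
    ultimately show ?thesis
      by (simp only: vol_avg_def I_def insert_commute[of Os O0])
  qed
  have vol1: "vol_avg f (dipyramid O1 Os A n) = I O1 / (real n * ((1 - s) * K) / 6)"
  proof -
    have "integral (dipyramid O1 Os A n) f = (\<Sum>k<n. integral (convex hull {O1, Os, A k, A (Suc k)}) f)"
      unfolding O1 Os by (rule integral_dipyramid) (use conv1 in \<open>simp add: O1 Os insert_commute\<close>)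
    moreover have "measure lebesgue (dipyramid O1 Os A n) = real n * ((1 - s) * K) / 6"
      unfolding O1 Os using s by (simp add: measure_dipyramid[OF ts_neq(2)] ts abs_mult K_def G_def)
    ultimately show ?thesis
      by (simp only: vol_avg_def I_def insert_commute[of Os O1])
  qed

  have cross_h: "norm (cross3 (h a - h x) (h b - h x)) = 9/16 * norm (cross3 (a - x) (b - x))" for a b x
  proof -
    have "h y - h x = (3/4) *\<^sub>R (y - x)" for y
      by (simp add: h_def homothety_def algebra_simps)
    then show ?thesis
      by (simp add: cross_mult_left cross_mult_right)
  qed
  \<comment> \<open>The face area has cancelled, so umbrella averages can be combined with the
    volume fractions \<open>s\<close> and \<open>1 - s\<close>.\<close>
  have umb: "surf_avg f (umbrella (C + z *\<^sub>R w) A n) = 2 / real n * S (C + z *\<^sub>R w)" for z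
    unfolding surf_avg_def umbrella_def
      surf_sums_equal_area[of n "\<lambda>k. A k" "\<lambda>_. C + z *\<^sub>R w" "\<lambda>k. A (Suc k)", OF norm_cross_face]
    using face_pos[of z] npos by (simp add: S_def field_simps)
  have map_umb: "map_surf h (umbrella X A n) = map (\<lambda>k. (h X, h (A k), h (A (Suc k)))) [0..<n]" for X
    by (simp add: map_surf_def umbrella_def)
  have hface: "norm (cross3 (h (A k) - h (C + z *\<^sub>R w)) (h (A (Suc k)) - h (C + z *\<^sub>R w))) = 9/16 * face_cross z" for k z
    by (simp add: cross_h norm_cross_face)
  have sums_h: "(\<Sum>T\<leftarrow>map_surf h (umbrella (C + z *\<^sub>R w) A n). tri_integral f T) = 9/16 * face_cross z * H (C + z *\<^sub>R w)"
      "(\<Sum>T\<leftarrow>map_surf h (umbrella (C + z *\<^sub>R w) A n). tri_area T) = real n * (9/16 * face_cross z) / 2" for z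
    unfolding map_umb H_def
    by (rule surf_sums_equal_area[of n "\<lambda>k. h (A k)" "\<lambda>_. h (C + z *\<^sub>R w)" "\<lambda>k. h (A (Suc k))", OF hface])+
  have humb: "surf_avg f (map_surf h (umbrella (C + z *\<^sub>R w) A n)) = 2 / real n * H (C + z *\<^sub>R w)" for z
    unfolding surf_avg_def sums_h using face_pos[of z] npos by (simp add: field_simps)
  define F0 where "F0 = face_cross t0"
  define F1 where "F1 = face_cross t1"
  have F: "F0 > 0" "F1 > 0"
    by (simp_all add: F0_def F1_def face_pos)
  \<comment> \<open>On the whole boundary the face areas no longer cancel: the two umbrellas are
    weighted in proportion to \<open>F0\<close> and \<open>F1\<close>.\<close>
  have bdry: "surf_avg f (map_surf h (dipyramid_boundary O0 O1 A n)) =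
      F0 / (F0 + F1) * (2 / real n * H O0) + F1 / (F0 + F1) * (2 / real n * H O1)"
  proof -
    have app: "map_surf h (dipyramid_boundary O0 O1 A n) =
        map_surf h (umbrella O0 A n) @ map_surf h (umbrella O1 A n)"
      by (simp add: dipyramid_boundary_def map_surf_def)
    have "surf_avg f (map_surf h (dipyramid_boundary O0 O1 A n)) =
        (9/16 * F0 * H O0 + 9/16 * F1 * H O1) / (real n * (9/16 * F0) / 2 + real n * (9/16 * F1) / 2)"
      unfolding surf_avg_def app map_append sum_list_append unfolding O0 O1 sums_h F0_def F1_def ..
    also have "\<dots> = (9/16 * (F0 * H O0 + F1 * H O1)) / (9/16 * (real n * (F0 + F1) / 2))"
      by (rule arg_cong2[where f = "(/)"]) (simp_all add: algebra_simps)
    also have "\<dots> = (F0 * H O0 + F1 * H O1) / (real n * (F0 + F1) / 2)"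
      by (rule mult_divide_mult_cancel_left) simp
    also have "\<dots> = F0 / (F0 + F1) * (2 / real n * H O0) + F1 / (F0 + F1) * (2 / real n * H O1)"
      using npos F by (simp add: field_simps) (simp add: add_divide_distrib)
    finally show ?thesis .
  qed
  \<comment> \<open>Used with \<open>x\<close>, \<open>y\<close> the two face areas: since each sine
    is \<open>G\<close> divided by its face area, the area weight of one umbrella is the sine weight
    carrying the angle of the other.\<close>
  have wt: "(G / x) / (G / y + G / x) = y / (x + y)" if "x > 0" "y > 0" for x y
  proof -
    have "G * x + G * y \<noteq> 0"
      using G that by (simp add: add_pos_pos less_imp_neq[symmetric])
    then show ?thesis
      using G that by (simp add: divide_simps) (simp add: algebra_simps)
  qed

  \<comment> \<open>The two parts at \<open>Os\<close> occupy the fractions \<open>s\<close> and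
    \<open>1 - s\<close> of the volume, so their upper bounds recombine with these weights.\<close>
  have "vol_avg f (dipyramid O0 O1 A n) \<le>
      (s * K * (real n * f Os / 24 + S O0 / 4) + (1 - s) * K * (real n * f Os / 24 + S O1 / 4)) / (real n * K / 6)"
    unfolding volD using I_le npos K by (intro divide_right_mono add_mono) auto
  also have "\<dots> = 1/4 * f Os + 3/4 * (s * (2 / real n * S O0) + (1 - s) * (2 / real n * S O1))"
    using npos K by (simp add: divide_simps) (simp add: algebra_simps)
  finally have 1: "vol_avg f (dipyramid O0 O1 A n) \<le>
      1/4 * f Os + 3/4 * (s * surf_avg f (umbrella O0 A n) + (1 - s) * surf_avg f (umbrella O1 A n))"
    by (simp add: O0 O1 umb)

  have "s * (2 / real n * H O0) + (1 - s) * (2 / real n * H O1) =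
      (s * K / 3 * H O0 + (1 - s) * K / 3 * H O1) / (real n * K / 6)"
    using npos K by (simp add: divide_simps) (simp add: algebra_simps)
  also have "\<dots> \<le> vol_avg f (dipyramid O0 O1 A n)"
    unfolding volD using I_ge npos K by (intro divide_right_mono add_mono) auto
  finally have 2: "s * surf_avg f (map_surf h (umbrella O0 A n))
      + (1 - s) * surf_avg f (map_surf h (umbrella O1 A n)) \<le> vol_avg f (dipyramid O0 O1 A n)"
    by (simp add: O0 O1 humb)

  \<comment> \<open>With \<open>c = s\<close> or \<open>c = 1 - s\<close> the volume fraction
    cancels, giving the lower bound on each part separately.\<close>
  have H_bound: "2 / real n * x \<le> y / (real n * (c * K) / 6)" if "c > 0" "c * K / 3 * x \<le> y" for c x y
  proof -
    have "2 / real n * x = (c * K / 3 * x) / (real n * (c * K) / 6)"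
      using npos K that(1) by simp
    also have "\<dots> \<le> y / (real n * (c * K) / 6)"
      using npos K that by (intro divide_right_mono) auto
    finally show ?thesis .
  qed
  have H_le: "2 / real n * H O0 \<le> vol_avg f (dipyramid O0 Os A n)"
      "2 / real n * H O1 \<le> vol_avg f (dipyramid O1 Os A n)"
    unfolding vol0 vol1 using H_bound I_ge s by simp_all
  have "surf_avg f (map_surf h (dipyramid_boundary O0 O1 A n)) \<le>
      F0 / (F0 + F1) * vol_avg f (dipyramid O0 Os A n) + F1 / (F0 + F1) * vol_avg f (dipyramid O1 Os A n)"
    unfolding bdry using H_le F by (intro add_mono mult_left_mono) auto
  then have 3: "surf_avg f (map_surf h (dipyramid_boundary O0 O1 A n)) \<le>
      (G / F1) / (G / F0 + G / F1) * vol_avg f (dipyramid O0 Os A n)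
      + (G / F0) / (G / F0 + G / F1) * vol_avg f (dipyramid O1 Os A n)"
    using wt[OF F(2,1)] wt[OF F] by (simp add: add.commute)
  have \<eta>: "sin (angle_line_plane w O0 (A 0) (A 1)) = G / F0" "sin (angle_line_plane w O1 (A 0) (A 1)) = G / F1"
    unfolding O0 O1 sin_angle_face G_def F0_def F1_def by (rule refl)+
  show ?thesis
    unfolding Let_def \<eta> Os_def[symmetric] h_def[symmetric] using 1 2 3 by blast
qed

end
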